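(* Let $\mathbb{K}$ be a field, $R=\mathbb{K}[x_0,x_1,x_2]$, and let $\mathcal{F}:\mathbb{P}^2_{\mathbb{K}}\dashrightarrow\mathbb{P}^2_{\mathbb{K}}$ be a dominant rational map defined by homogeneous polynomials $f_0,f_1,f_2\in R$ of the same degree $d$, such that $I=(f_0,f_1,f_2)$ is saturated and $\dim(R/I)=1$. Suppose that $I$ has a Hilbert–Burch presentation $$0\to R(-d-1)\oplus R(-d-(d-1))\xrightarrow{\ \varphi\ }R(-d)^3\to I\to0,\qquad\varphi=\begin{pmatrix}x_0&p_0\\-x_1&p_1\\0&p_2\end{pmatrix},$$ where $d-1\ge 1$ and $I$ is generated by the maximal minors of $\varphi$. Put $g_1=x_0y_0-x_1y_1$, $g_2=p_0y_0+p_1y_1+p_2y_2$ and let $\mathrm{Sylv}=\{F_1,\ldots,F_m\}$ be the set of Sylvester forms computed by the algorithm described in the context. Then the defining equations of the Rees algebra $\mathcal{R}(I)$, i.e. the ideal $\mathrm{Ker}\big(\mathcal{A}\to\mathcal{R}(I)\big)$, are minimally generated by $$\{g_1,g_2\}\cup\mathrm{Sylv}.$$ In particular, this ideal is minimally generated in the bi-degrees $$(1,1),\ (d-1,1),\ (d-2,2),\ \ldots,\ (d-1-m,m+1).$$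
   Context: $\mathcal{A}=\mathbb{K}[x_0,x_1,x_2,y_0,y_1,y_2]$ is bigraded with $x_i$ of bi-degree $(1,0)$ and $y_j$ of bi-degree $(0,1)$. $\mathcal{R}(I)=\bigoplus_{n\ge0}I^nt^n$ is presented by the $R$-algebra map $\mathcal{A}\to\mathcal{R}(I)$, $y_j\mapsto f_jt$. $I$ saturated means $I=(I:(x_0,x_1,x_2)^\infty)$. Algorithm (Sylvester forms). Start with $i=0$, $F_0=g_2$, $\mathrm{Sylv}=\emptyset$. While $F_i\in(x_0,x_1)$: write $F_i=(F_i)_{x_0}x_0+(F_i)_{x_1}x_1$ with $(F_i)_{x_0},(F_i)_{x_1}\in\mathcal{A}$ bi-homogeneous, set $$F_{i+1}=\det\begin{pmatrix}y_0&-y_1\\(F_i)_{x_0}&(F_i)_{x_1}\end{pmatrix},$$ add $F_{i+1}$ to $\mathrm{Sylv}$, and replace $i$ by $i+1$. When $F_i\notin(x_0,x_1)$, stop, put $m=i$ and return $\mathrm{Sylv}=\{F_1,\ldots,F_m\}$ (empty if $m=0$). The form $F_i$ has bi-degree $(d-1-i,i+1)$. *)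

theory Defs
  imports
    "HOL-Analysis.Analysis"
    "HOL-Library.Poly_Mapping"
    "HOL-Computational_Algebra.Polynomial"
    "HOL-Algebra.QuotRing"
    "HOL-Algebra.Ideal_Product"
    "HOL-Decision_Procs.Algebra_Aux"
begin

section \<open>Polynomial rings\<close>

text \<open>
  \<open>('v, 'k) mpoly\<close> is the polynomial ring over \<open>'k\<close> with one variable for each element of the
  finite type \<open>'v\<close>: a finitely supported function from exponent vectors to coefficients.
\<close>

type_synonym ('v, 'k) mpoly = "('v \<Rightarrow>\<^sub>0 nat) \<Rightarrow>\<^sub>0 'k"

definition Const :: "'k \<Rightarrow> ('v, 'k::zero) mpoly"
  where "Const c = Poly_Mapping.single 0 c"

definition Var :: "'v \<Rightarrow> ('v, 'k::zero_neq_one) mpoly"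
  where "Var v = Poly_Mapping.single (Poly_Mapping.single v 1) 1"

text \<open>Evaluation: coefficients are mapped by \<open>c\<close>, the variable \<open>v\<close> is replaced by \<open>s v\<close>.\<close>

definition mpoly_eval ::
  "('k \<Rightarrow> 'b) \<Rightarrow> ('v::finite \<Rightarrow> 'b) \<Rightarrow> ('v, 'k::zero) mpoly \<Rightarrow> 'b::comm_ring_1"
  where "mpoly_eval c s p =
    (\<Sum>m\<in>Poly_Mapping.keys p. c (Poly_Mapping.lookup p m) * (\<Prod>v\<in>UNIV. s v ^ Poly_Mapping.lookup m v))"

definition homogeneous :: "nat \<Rightarrow> ('v::finite, 'k::zero) mpoly \<Rightarrow> bool"
  where "homogeneous n p \<longleftrightarrow>
    (\<forall>m\<in>Poly_Mapping.keys p. (\<Sum>v\<in>UNIV. Poly_Mapping.lookup m v) = n)"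

text \<open>
  The ring \<open>R = K[x\<^sub>0, x\<^sub>1, x\<^sub>2]\<close> and the bigraded ring \<open>A = K[x\<^sub>0, x\<^sub>1, x\<^sub>2, y\<^sub>0, y\<^sub>1, y\<^sub>2]\<close>.
  The index \<open>k \<in> {0, 1, 2}\<close> of the mathematical text is the element \<open>k + 1\<close> of the type \<open>3\<close>,
  in accordance with the indexing of \<^const>\<open>vector\<close> (note \<open>3 = 0\<close> in that type). In \<open>A\<close>,
  the variables indexed by \<^const>\<open>Inl\<close> are the \<open>x\<^sub>i\<close>, those indexed by \<^const>\<open>Inr\<close> the \<open>y\<^sub>j\<close>.
\<close>

type_synonym 'k R = "(3, 'k) mpoly"
type_synonym 'k A = "(3 + 3, 'k) mpoly"

abbreviation rx0 :: "'k::field R" where "rx0 \<equiv> Var 1"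
abbreviation rx1 :: "'k::field R" where "rx1 \<equiv> Var 2"
abbreviation rx2 :: "'k::field R" where "rx2 \<equiv> Var 3"

abbreviation x0 :: "'k::field A" where "x0 \<equiv> Var (Inl 1)"
abbreviation x1 :: "'k::field A" where "x1 \<equiv> Var (Inl 2)"
abbreviation y0 :: "'k::field A" where "y0 \<equiv> Var (Inr 1)"
abbreviation y1 :: "'k::field A" where "y1 \<equiv> Var (Inr 2)"
abbreviation y2 :: "'k::field A" where "y2 \<equiv> Var (Inr 3)"

definition R_to_A :: "'k::field R \<Rightarrow> 'k A"
  where "R_to_A = mpoly_eval Const (\<lambda>i. Var (Inl i))"

definition bihomogeneous :: "nat \<times> nat \<Rightarrow> 'k::field A \<Rightarrow> bool"
  where "bihomogeneous = (\<lambda>(a, b) p. \<forall>m\<in>Poly_Mapping.keys p.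
    (\<Sum>i\<in>UNIV. Poly_Mapping.lookup m (Inl i)) = a \<and> (\<Sum>j\<in>UNIV. Poly_Mapping.lookup m (Inr j)) = b)"


section \<open>Ideals\<close>

text \<open>
  \<^const>\<open>cring_class_ops\<close> is the type-class ring on a whole type, regarded as a ring in the sense
  of HOL-Algebra.
\<close>

abbreviation ideal_gen :: "'a::comm_ring_1 set \<Rightarrow> 'a set"
  where "ideal_gen S \<equiv> Idl\<^bsub>cring_class_ops\<^esub> S"

abbreviation ideal_power :: "'a::comm_ring_1 set \<Rightarrow> nat \<Rightarrow> 'a set"
  where "ideal_power I n \<equiv> I [^]\<^bsub>ideals_set cring_class_ops\<^esub> n"

definition ideal_saturation :: "'a::comm_ring_1 set \<Rightarrow> 'a set \<Rightarrow> 'a set"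
  where "ideal_saturation I M = {r. \<exists>n. \<forall>s\<in>ideal_power M n. r * s \<in> I}"

definition saturated :: "'k::field R set \<Rightarrow> bool"
  where "saturated I \<longleftrightarrow> I = ideal_saturation I (ideal_gen {rx0, rx1, rx2})"

text \<open>The Krull dimension of the zero ring is \<open>-\<infinity>\<close>.\<close>

definition krull_dim :: "('a, 'b) ring_scheme \<Rightarrow> ereal"
  where "krull_dim S = (SUP n \<in> {n. \<exists>P :: nat \<Rightarrow> 'a set.
    (\<forall>i\<le>n. primeideal (P i) S) \<and> (\<forall>i<n. P i \<subset> P (Suc i))}. ereal (real n))"

definition minimally_generates :: "'a::comm_ring_1 set \<Rightarrow> 'a set \<Rightarrow> bool"
  where "minimally_generates G J \<longleftrightarrow> ideal_gen G = J \<and> (\<forall>H. H \<subset> G \<longrightarrow> ideal_gen H \<noteq> J)"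

text \<open>
  The list \<open>ds\<close> records the bidegrees with multiplicity: \<open>J\<close> has a minimal generating set
  consisting of \<open>length ds\<close> distinct bihomogeneous elements of these bidegrees.
  The elements are required to be nonzero, as \<open>0\<close> is bihomogeneous of every bidegree.
\<close>

definition minimally_generated_in_bidegrees :: "'k::field A set \<Rightarrow> (nat \<times> nat) list \<Rightarrow> bool"
  where "minimally_generated_in_bidegrees J ds \<longleftrightarrow>
    (\<exists>gs. distinct gs \<and> minimally_generates (set gs) J \<and>
      list_all2 (\<lambda>g e. g \<noteq> 0 \<and> bihomogeneous e g) gs ds)"


section \<open>Dominant rational maps of the projective plane\<close>

text \<open>
  The points of \<open>Proj R\<close>: homogeneous primes, i.e. primes generated by homogeneous elements,
  that do not contain the irrelevant ideal.
\<close>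

definition proj_points :: "'k::field R set set"
  where "proj_points = {P. primeideal P cring_class_ops \<and>
    P = ideal_gen {p \<in> P. \<exists>n. homogeneous n p} \<and> \<not> {rx0, rx1, rx2} \<subseteq> P}"

definition proj_topology :: "'k::field R set topology"
  where "proj_topology =
    topology_generated_by {{P \<in> proj_points. h \<notin> P} |h. \<exists>n. homogeneous n h}"

text \<open>
  For \<open>f\<close> given by three forms of the same degree, the rational map \<open>(f\<^sub>0 : f\<^sub>1 : f\<^sub>2)\<close> is defined
  at the points \<open>P\<close> that do not contain all the \<open>f\<^sub>j\<close>, and sends such a \<open>P\<close> to its preimage under
  the ring map \<open>y\<^sub>j \<mapsto> f\<^sub>j\<close>. The coordinate ring of the target is identified with \<open>R\<close>.
  Over an arbitrary field, density of the image has to be taken in the scheme-theoretic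
  projective plane, not in its set of rational points.
\<close>

definition rational_map_image :: "'k::field R^3 \<Rightarrow> 'k R set set"
  where "rational_map_image f =
    {{h. mpoly_eval Const (\<lambda>j. f $ j) h \<in> P} |P. P \<in> proj_points \<and> \<not> (\<forall>j. f $ j \<in> P)}"

definition dominant :: "'k::field R^3 \<Rightarrow> bool"
  where "dominant f \<longleftrightarrow>
    proj_topology closure_of rational_map_image f = topspace proj_topology"


section \<open>Hilbert--Burch presentations\<close>

text \<open>
  The complex \<open>0 \<rightarrow> R(-d-e\<^sub>1) \<oplus> R(-d-e\<^sub>2) \<rightarrow> R(-d)\<^sup>3 \<rightarrow> I \<rightarrow> 0\<close> with maps \<open>\<phi>\<close> and \<open>f\<close> is exact and
  graded. That \<open>\<phi>\<close> and \<open>f\<close> respect the twists amounts to the degree conditions on their entries.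
\<close>

definition hilbert_burch_presentation ::
  "nat \<Rightarrow> nat \<Rightarrow> nat \<Rightarrow> 'k::field R^2^3 \<Rightarrow> 'k R^3 \<Rightarrow> 'k R set \<Rightarrow> bool"
  where "hilbert_burch_presentation d e1 e2 \<phi> f I \<longleftrightarrow>
    (\<forall>i. homogeneous e1 (\<phi> $ i $ 1) \<and> homogeneous e2 (\<phi> $ i $ 2) \<and> homogeneous d (f $ i)) \<and>
    inj ((*v) \<phi>) \<and>
    range ((*v) \<phi>) = {u. (\<Sum>i\<in>UNIV. f $ i * u $ i) = 0} \<and>
    range (\<lambda>u. \<Sum>i\<in>UNIV. f $ i * u $ i) = I"

text \<open>The choices \<open>s\<close> of rows are not assumed increasing, so each minor occurs with both signs.\<close>

definition maximal_minors :: "'a::comm_ring_1^'n^'m \<Rightarrow> 'a set"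
  where "maximal_minors M = {det (\<chi> i j. M $ s i $ j) |s :: 'n \<Rightarrow> 'm. inj s}"


section \<open>The Rees algebra\<close>

text \<open>\<open>\<Oplus>\<^sub>n I\<^sup>n t\<^sup>n\<close> as a subring of \<open>R[t]\<close>.\<close>

definition rees_algebra :: "'a::comm_ring_1 set \<Rightarrow> 'a poly ring"
  where "rees_algebra I = cring_class_ops\<lparr>carrier := {q. \<forall>n. coeff q n \<in> ideal_power I n}\<rparr>"

text \<open>The \<open>R\<close>-algebra map \<open>y\<^sub>j \<mapsto> f\<^sub>j t\<close>.\<close>

definition rees_map :: "'k::field R^3 \<Rightarrow> 'k A \<Rightarrow> 'k R poly"
  where "rees_map f = mpoly_eval (\<lambda>a. [:Const a:])
    (\<lambda>v. case v of Inl i \<Rightarrow> [:Var i:] | Inr j \<Rightarrow> Polynomial.monom (f $ j) 1)"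

definition rees_ideal :: "'k::field R^3 \<Rightarrow> 'k R set \<Rightarrow> 'k A set"
  where "rees_ideal f I = a_kernel cring_class_ops (rees_algebra I) (rees_map f)"


section \<open>Sylvester forms\<close>

text \<open>
  \<open>F\<close> restricted to \<open>{0..m}\<close> is a run of the algorithm that starts with \<open>g\<close> and stops with
  output \<open>{F 1, \<dots>, F m}\<close>. The decomposition \<open>F i = a x\<^sub>0 + b x\<^sub>1\<close> is not unique,
  so there may be several runs.
\<close>

definition sylvester_run :: "'k::field A \<Rightarrow> (nat \<Rightarrow> 'k A) \<Rightarrow> nat \<Rightarrow> bool"
  where "sylvester_run g F m \<longleftrightarrow>
    F 0 = g \<and>
    (\<forall>i<m. F i \<in> ideal_gen {x0, x1} \<and>
      (\<exists>a b. (\<exists>e. bihomogeneous e a) \<and> (\<exists>e. bihomogeneous e b) \<and>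
        F i = a * x0 + b * x1 \<and>
        F (Suc i) = det (vector [vector [y0, - y1], vector [a, b]] :: 'k A^2^2))) \<and>
    F m \<notin> ideal_gen {x0, x1}"

end

theory Submission
  imports Defs
begin

text \<open>
  Write \<open>T = R[w, y\<^sub>2]\<close> (in the formal text, polynomials in \<open>y\<^sub>2\<close> over polynomials in \<open>w\<close>). The form
  \<open>g\<^sub>1 = x\<^sub>0 y\<^sub>0 - x\<^sub>1 y\<^sub>1\<close> is the binomial of a toric variety, and the substitution
  \<open>y\<^sub>0 \<mapsto> x\<^sub>1 w\<close>, \<open>y\<^sub>1 \<mapsto> x\<^sub>0 w\<close> parametrizes it: the resulting map \<open>param : A \<rightarrow> T\<close> has kernel \<open>(g\<^sub>1)\<close>,
  and its image consists of the elements whose coefficient at \<open>w\<^sup>k y\<^sub>2\<^sup>l\<close> lies in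
  \<open>(x\<^sub>0, x\<^sub>1)\<^sup>k\<close>, for all \<open>k\<close> and \<open>l\<close>. In \<open>T\<close> the algorithm becomes transparent. The fractions \<open>y\<^sub>1 / x\<^sub>0\<close> and
  \<open>y\<^sub>0 / x\<^sub>1\<close> both equal \<open>w\<close>, and replacing \<open>F\<^sub>i\<close> by \<open>F\<^sub>i\<^sub>+\<^sub>1\<close> is multiplication by \<open>w\<close>.
  So \<open>F\<^sub>i\<close> has the image \<open>w\<^sup>i G\<close>, where
  \<open>G = \<alpha> w + p\<^sub>2 y\<^sub>2\<close> is the image of \<open>g\<^sub>2\<close> and \<open>\<alpha> = x\<^sub>1 p\<^sub>0 + x\<^sub>0 p\<^sub>1\<close>; and \<open>F\<^sub>i \<in> (x\<^sub>0, x\<^sub>1)\<close> says that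
  the coefficients of \<open>w\<^sup>i G\<close> vanish to one order more than the image of \<open>param\<close> demands.
  The number \<open>m\<close> therefore does not depend on the choices made: it is the largest number such that
  \<open>p\<^sub>2\<close> vanishes to order \<open>m\<close> and \<open>\<alpha>\<close> to order \<open>m + 1\<close> along \<open>x\<^sub>0 = x\<^sub>1 = 0\<close>.

  The presentation forces \<open>f\<^sub>0 = x\<^sub>1 h\<close> and \<open>f\<^sub>1 = x\<^sub>0 h\<close> with \<open>h \<alpha> + f\<^sub>2 p\<^sub>2 = 0\<close>, so the map from \<open>A\<close> to the
  Rees algebra factors through \<open>param\<close> and the substitution \<open>w \<mapsto> h t\<close>, \<open>y\<^sub>2 \<mapsto> f\<^sub>2 t\<close>. Exactness of the
  presentation makes \<open>\<alpha>\<close> and \<open>p\<^sub>2\<close> coprime (\<open>coprime_alpha_p2\<close>), so the kernel of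
  this substitution is generated by \<open>G\<close>, as in the lemma of Gauss (\<open>specialize_eq_0_imp_G_dvd\<close>). Hence \<open>q\<close> lies in the
  defining ideal if and only if its image is a multiple \<open>E G\<close>. Order of vanishing is a valuation, and
  comparing orders in \<open>E G\<close> shows that the coefficient of \<open>E\<close> at \<open>w\<^sup>k y\<^sub>2\<^sup>l\<close> vanishes to order \<open>k - m\<close>
  (\<open>vanishes_cofactor\<close>). Taking out \<open>w\<^sup>i\<close> with \<open>i = min k m\<close>, each term of \<open>E G\<close> is the
  image of a multiple of \<open>F\<^sub>i\<close>, which gives generation (\<open>rees_ideal_generated\<close>).

  Minimality is a matter of bidegrees. Among the forms \<open>F\<^sub>0, \<dots>, F\<^sub>m\<close> the \<open>x\<close>-degree decreases and the
  \<open>y\<close>-degree increases, so no \<open>F\<^sub>j\<close> with \<open>j \<noteq> i\<close> contributes in the bidegree of \<open>F\<^sub>i\<close>, while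
  \<open>F\<^sub>i\<close> is not a multiple of \<open>g\<^sub>1\<close>; and in bidegree \<open>(1, 1)\<close> only \<open>F\<^sub>0\<close> could produce \<open>g\<^sub>1\<close>.
\<close>


section \<open>Ideals as spans\<close>

interpretation ideal: module "(*) :: 'a::comm_ring_1 \<Rightarrow> 'a \<Rightarrow> 'a"
  by unfold_locales (simp_all add: algebra_simps)

text \<open>
  In a ring this rule is reversed associativity, which would loop against \<open>mult.assoc\<close>.
\<close>

declare ideal.scale_scale [simp del]

abbreviation ideal_span :: "'a::comm_ring_1 set \<Rightarrow> 'a set"
  where "ideal_span \<equiv> module.span (*)"

lemma ideal_gen_eq_span: "ideal_gen S = ideal_span S"
proof
  have "Ideal.ideal (ideal_span S) cring_class_ops"
  proof (rule cring_class.cring_axioms[THEN cring.axioms(1), THEN idealI])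
    show "subgroup (ideal_span S) (add_monoid cring_class_ops)"
    proof (rule group.subgroupI[OF abelian_group.a_group[OF cring_class.is_abelian_group]])
      show "ideal_span S \<noteq> {}" using ideal.span_zero by blast
      fix a assume a: "a \<in> ideal_span S"
      show "inv\<^bsub>add_monoid cring_class_ops\<^esub> a \<in> ideal_span S"
        using ideal.span_neg[OF a] unfolding a_inv_def[symmetric] uminus_class .
      show "a \<otimes>\<^bsub>add_monoid cring_class_ops\<^esub> b \<in> ideal_span S" if "b \<in> ideal_span S" for b
        using ideal.span_add[OF a that] by (simp add: cring_class_ops_def)
    qed (simp add: cring_class_ops_def)
    show "x \<otimes>\<^bsub>cring_class_ops\<^esub> a \<in> ideal_span S" "a \<otimes>\<^bsub>cring_class_ops\<^esub> x \<in> ideal_span S"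
      if "a \<in> ideal_span S" for a x
      unfolding times_class using ideal.span_scale[OF that, of x] by (simp_all add: mult.commute)
  qed
  then show "ideal_gen S \<subseteq> ideal_span S"
    by (rule ring.genideal_minimal[OF cring.axioms(1)[OF cring_class]]) (rule ideal.span_superset)
next
  have id: "Ideal.ideal (ideal_gen S) cring_class_ops"
    by (rule ring.genideal_ideal[OF cring.axioms(1)[OF cring_class]]) (simp add: cring_class_ops_def)
  have "S \<subseteq> ideal_gen S"
    by (rule ring.genideal_self[OF cring.axioms(1)[OF cring_class]]) (simp add: cring_class_ops_def)
  moreover have "ideal.subspace (ideal_gen S)"
  proof (rule ideal.subspaceI)
    show "0 \<in> ideal_gen S"
      using additive_subgroup.zero_closed[OF ideal.axioms(1)[OF id]] by (simp add: cring_class_ops_def)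
    show "x + y \<in> ideal_gen S" if "x \<in> ideal_gen S" "y \<in> ideal_gen S" for x y
      using additive_subgroup.a_closed[OF ideal.axioms(1)[OF id] that] by (simp add: cring_class_ops_def)
    show "c * x \<in> ideal_gen S" if "x \<in> ideal_gen S" for c x
      using ideal.I_l_closed[OF id that, of c] by (simp add: cring_class_ops_def)
  qed
  ultimately show "ideal_span S \<subseteq> ideal_gen S"
    by (rule ideal.span_minimal)
qed

lemma ideal_span_dvd:
  "x \<in> ideal_span {a} \<longleftrightarrow> a dvd x"
  by (auto simp: ideal.span_singleton dvd_def mult.commute)

lemma ideal_span_pair:
  "x \<in> ideal_span {a, b} \<longleftrightarrow> (\<exists>r s. x = r * a + s * b)"
  by (simp add: ideal.span_insert ideal.span_singleton) (metis add_diff_cancel_left' add_diff_eq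
      diff_add_cancel)

section \<open>Evaluation homomorphisms\<close>

locale ring_morphism =
  fixes h :: "'a::comm_ring_1 \<Rightarrow> 'b::comm_ring_1"
  assumes add: "h (x + y) = h x + h y"
    and mult: "h (x * y) = h x * h y"
    and one: "h 1 = 1"
begin

lemma zero: "h 0 = 0"
  using add[of 0 0] by simp

lemma uminus: "h (- x) = - h x"
  using add[of x "- x"] zero by (simp add: add_eq_0_iff)

lemma diff: "h (x - y) = h x - h y"
  using add[of x "- y"] uminus by simp

lemma power: "h (x ^ n) = h x ^ n"
  by (induction n) (simp_all add: one mult)

lemma sum: "h (sum f S) = (\<Sum>i\<in>S. h (f i))"
  by (induction S rule: infinite_finite_induct) (simp_all add: zero add)

lemma prod: "h (prod f S) = (\<Prod>i\<in>S. h (f i))"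
  by (induction S rule: infinite_finite_induct) (simp_all add: one mult)

lemmas simps = zero one add mult uminus diff power sum prod

lemma mpoly_eval: "h (mpoly_eval c s p) = mpoly_eval (\<lambda>a. h (c a)) (\<lambda>v. h (s v)) p"
  by (simp add: mpoly_eval_def simps)

end

lemma ring_morphism_const_poly:
  "ring_morphism h \<Longrightarrow> ring_morphism (\<lambda>x. [:h x:])"
  by (simp add: ring_morphism_def)

lemma ring_morphism_id: "ring_morphism (\<lambda>x. x)"
  by unfold_locales auto

lemma ring_morphism_Const: "ring_morphism (Const :: 'k::field \<Rightarrow> ('v, 'k) mpoly)"
  by unfold_locales (simp_all add: Const_def single_add mult_single)

interpretation Const: ring_morphism "Const :: 'k::field \<Rightarrow> ('v, 'k) mpoly"
  by (rule ring_morphism_Const)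

lemma poly_mapping_sum_single:
  "p = (\<Sum>m\<in>Poly_Mapping.keys p. Poly_Mapping.single m (Poly_Mapping.lookup p m))"
  by (rule poly_mapping_eqI)
    (simp add: lookup_sum lookup_single when_def sum.delta in_keys_iff)

lemma mpoly_induct [case_names single add]:
  assumes "\<And>m a. P (Poly_Mapping.single m a)"
    and "\<And>p q. P p \<Longrightarrow> P q \<Longrightarrow> P (p + q)"
  shows "P (p :: ('v, 'k::comm_monoid_add) mpoly)"
proof -
  have "P (\<Sum>m\<in>K. Poly_Mapping.single m (Poly_Mapping.lookup p m))" if "finite K" for K
    using that by (induction K) (use assms assms(1)[of 0 0] in auto)
  then show ?thesis
    by (subst poly_mapping_sum_single) simp
qed

context
  fixes c :: "'k::field \<Rightarrow> 'b::comm_ring_1" and s :: "'v::finite \<Rightarrow> 'b"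
  assumes c: "ring_morphism c"
begin

interpretation c: ring_morphism c by (rule c)

lemma mpoly_eval_single:
  "mpoly_eval c s (Poly_Mapping.single m a) = c a * (\<Prod>v\<in>UNIV. s v ^ Poly_Mapping.lookup m v)"
  by (simp add: mpoly_eval_def c.zero)

lemma mpoly_eval_superset:
  assumes "finite K" "Poly_Mapping.keys p \<subseteq> K"
  shows "mpoly_eval c s p =
    (\<Sum>m\<in>K. c (Poly_Mapping.lookup p m) * (\<Prod>v\<in>UNIV. s v ^ Poly_Mapping.lookup m v))"
  unfolding mpoly_eval_def
  by (rule sum.mono_neutral_left) (use assms in \<open>auto simp: in_keys_iff c.zero\<close>)

lemma mpoly_eval_add: "mpoly_eval c s (p + q) = mpoly_eval c s p + mpoly_eval c s q"
proof -
  let ?K = "Poly_Mapping.keys p \<union> Poly_Mapping.keys q"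
  have "Poly_Mapping.keys (p + q) \<subseteq> ?K"
    by (rule keys_add)
  then show ?thesis
    by (subst (1 2 3) mpoly_eval_superset[of ?K])
      (auto simp: lookup_add c.add distrib_right sum.distrib)
qed

lemma ring_morphism_mpoly_eval: "ring_morphism (mpoly_eval c s)"
proof
  show "mpoly_eval c s (p * q) = mpoly_eval c s p * mpoly_eval c s q" for p q
  proof (induction p rule: mpoly_induct)
    case (single m a)
    show ?case
    proof (induction q rule: mpoly_induct)
      case (single n b)
      show ?case
        unfolding mult_single mpoly_eval_single c.mult lookup_add power_add prod.distrib
        by (rule mult.assoc[THEN trans], subst mult.left_commute) (simp only: mult.assoc)
    next
      case (add p q)
      then show ?case
        unfolding distrib_left mpoly_eval_add by (simp only:)
    qed
  next
    case (add p q)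
    then show ?case
      unfolding distrib_right mpoly_eval_add by (simp only:)
  qed
  show "mpoly_eval c s 1 = 1"
    using mpoly_eval_single[of 0 1] by (simp add: c.one)
qed (rule mpoly_eval_add)

lemma mpoly_eval_Const: "mpoly_eval c s (Const a) = c a"
  unfolding Const_def by (subst mpoly_eval_single) simp_all

lemma mpoly_eval_Var: "mpoly_eval c s (Var v) = s v"
proof -
  have "s u ^ (1 when v = u) = (if u = v then s v else 1)" for u
    by (auto simp: when_def)
  then show ?thesis
    unfolding Var_def by (subst mpoly_eval_single) (simp add: c.one lookup_single)
qed

end

lemma Var_power: "(Var v :: ('v, 'k::field) mpoly) ^ n = Poly_Mapping.single (Poly_Mapping.single v n) 1"
  by (induction n) (simp_all add: Var_def mult_single single_add[symmetric])

lemma single_eq_Const_Var: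
  "Poly_Mapping.single m (a :: 'k::field) =
    Const a * (\<Prod>v\<in>UNIV. (Var v :: ('v::finite, 'k) mpoly) ^ Poly_Mapping.lookup m v)"
proof -
  have *: "(\<Prod>v\<in>S. (Var v :: ('v::finite, 'k) mpoly) ^ Poly_Mapping.lookup m v) =
    Poly_Mapping.single (\<Sum>v\<in>S. Poly_Mapping.single v (Poly_Mapping.lookup m v)) 1" for S
    by (induction S rule: infinite_finite_induct) (simp_all add: Var_power mult_single)
  have "(\<Sum>v\<in>UNIV. Poly_Mapping.single v (Poly_Mapping.lookup m v)) = m"
    by (rule poly_mapping_eqI) (simp add: lookup_sum lookup_single when_def)
  then show ?thesis
    by (simp add: * Const_def mult_single)
qed

lemma mpoly_eval_Const_Var: "mpoly_eval Const Var p = (p :: ('v::finite, 'k::field) mpoly)"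
  unfolding mpoly_eval_def single_eq_Const_Var[symmetric] by (rule poly_mapping_sum_single[symmetric])

lemma prod_UNIV_sum:
  "(\<Prod>v\<in>UNIV. f v) = (\<Prod>i\<in>UNIV. f (Inl i)) * (\<Prod>j\<in>UNIV. f (Inr j))"
  for f :: "'a::finite + 'b::finite \<Rightarrow> 'c::comm_monoid_mult"
  unfolding UNIV_sum by (subst prod.union_disjoint) (auto simp: prod.reindex)

lemma prod_UNIV_3: "(\<Prod>i\<in>UNIV. f i) = f 1 * f 2 * f (3::3)"
  for f :: "3 \<Rightarrow> 'c::comm_monoid_mult"
  unfolding UNIV_3 by (simp add: ac_simps)

lemma R_induct [case_names monomial add]:
  assumes "\<And>k a b c. P (Const k * rx0 ^ a * rx1 ^ b * rx2 ^ c)"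
    and "\<And>p q. P p \<Longrightarrow> P q \<Longrightarrow> P (p + q)"
  shows "P (p :: 'k::field R)"
proof (induction p rule: mpoly_induct)
  case (single m a)
  show ?case
    unfolding single_eq_Const_Var prod_UNIV_3 mult.assoc[symmetric] by (rule assms(1))
qed (rule assms(2))

lemma A_induct [case_names monomial add]:
  assumes "\<And>k a b c d e f. P (Const k * x0 ^ a * x1 ^ b * Var (Inl 3) ^ c * y0 ^ d * y1 ^ e * y2 ^ f)"
    and "\<And>p q. P p \<Longrightarrow> P q \<Longrightarrow> P (p + q)"
  shows "P (p :: 'k::field A)"
proof (induction p rule: mpoly_induct)
  case (single m a)
  show ?case
    unfolding single_eq_Const_Var prod_UNIV_sum prod_UNIV_3 mult.assoc[symmetric] by (rule assms(1))
qed (rule assms(2))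


section \<open>The bigrading\<close>

definition bidegree :: "(3 + 3 \<Rightarrow>\<^sub>0 nat) \<Rightarrow> nat \<times> nat"
  where "bidegree m = (\<Sum>i\<in>UNIV. Poly_Mapping.lookup m (Inl i), \<Sum>j\<in>UNIV. Poly_Mapping.lookup m (Inr j))"

lemma bihomogeneous_iff: "bihomogeneous e p \<longleftrightarrow> (\<forall>m\<in>Poly_Mapping.keys p. bidegree m = e)"
  by (cases e) (auto simp: bihomogeneous_def bidegree_def)

lemma bidegree_add: "bidegree (m + n) = bidegree m + bidegree n"
  by (simp add: bidegree_def lookup_add sum.distrib)

lemma bihomogeneous_add: "bihomogeneous e p \<Longrightarrow> bihomogeneous e q \<Longrightarrow> bihomogeneous e (p + q)"
  unfolding bihomogeneous_iff using keys_add[of p q] by blast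

lemma bihomogeneous_0: "bihomogeneous e 0"
  by (simp add: bihomogeneous_iff)

lemma bihomogeneous_uminus: "bihomogeneous e p \<Longrightarrow> bihomogeneous e (- p)"
  by (simp add: bihomogeneous_iff in_keys_iff)

lemma bihomogeneous_diff: "bihomogeneous e p \<Longrightarrow> bihomogeneous e q \<Longrightarrow> bihomogeneous e (p - q)"
  using bihomogeneous_add[of e p "- q"] bihomogeneous_uminus[of e q] by simp

lemma bihomogeneous_sum:
  "(\<And>i. i \<in> S \<Longrightarrow> bihomogeneous e (f i)) \<Longrightarrow> bihomogeneous e (sum f S)"
  by (induction S rule: infinite_finite_induct) (simp_all add: bihomogeneous_0 bihomogeneous_add)

lemma bihomogeneous_mult:
  assumes "bihomogeneous e p" "bihomogeneous e' q"
  shows "bihomogeneous (e + e') (p * q)"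
  unfolding bihomogeneous_iff
proof
  fix m assume "m \<in> Poly_Mapping.keys (p * q)"
  then obtain a b where "m = a + b" "a \<in> Poly_Mapping.keys p" "b \<in> Poly_Mapping.keys q"
    using keys_mult[of p q] by blast
  then show "bidegree m = e + e'"
    using assms by (simp add: bihomogeneous_iff bidegree_add)
qed

lemma bihomogeneous_single: "bihomogeneous (bidegree m) (Poly_Mapping.single m a)"
  by (simp add: bihomogeneous_iff)

lemma bihomogeneous_Const: "bihomogeneous (0, 0) (Const a)"
  by (simp add: bihomogeneous_def Const_def)

lemma bihomogeneous_Inl: "bihomogeneous (1, 0) (Var (Inl i))"
  by (simp add: bihomogeneous_def Var_def lookup_single when_def)

lemma bihomogeneous_Inr: "bihomogeneous (0, 1) (Var (Inr j))"
  by (simp add: bihomogeneous_def Var_def lookup_single when_def)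

lemma bihomogeneous_power: "bihomogeneous (a, b) p \<Longrightarrow> bihomogeneous (n * a, n * b) (p ^ n)"
proof (induction n)
  case 0
  show ?case using bihomogeneous_Const[of 1] by (simp add: Const.one)
next
  case (Suc n)
  then show ?case using bihomogeneous_mult[of "(a, b)" p "(n * a, n * b)" "p ^ n"] by simp
qed

lemma bihomogeneous_prod:
  "(\<And>i. i \<in> S \<Longrightarrow> bihomogeneous (a i, b i) (f i)) \<Longrightarrow> bihomogeneous (sum a S, sum b S) (prod f S)"
proof (induction S rule: infinite_finite_induct)
  case (insert x S)
  then show ?case using bihomogeneous_mult[of "(a x, b x)" "f x" "(sum a S, sum b S)" "prod f S"] by simp
qed (use bihomogeneous_Const[of 1] in \<open>simp_all add: Const.one\<close>)

lemma bihomogeneous_R_to_A: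
  assumes "homogeneous n p"
  shows "bihomogeneous (n, 0) (R_to_A p)"
  unfolding R_to_A_def mpoly_eval_def
proof (rule bihomogeneous_sum)
  fix m assume m: "m \<in> Poly_Mapping.keys p"
  have "bihomogeneous (\<Sum>v\<in>UNIV. Poly_Mapping.lookup m v, \<Sum>v\<in>(UNIV::3 set). 0)
    (\<Prod>v\<in>UNIV. (Var (Inl v) :: 'a A) ^ Poly_Mapping.lookup m v)"
    by (rule bihomogeneous_prod) (use bihomogeneous_power[OF bihomogeneous_Inl] in fastforce)
  then have "bihomogeneous (n, 0) (\<Prod>v\<in>UNIV. (Var (Inl v) :: 'a A) ^ Poly_Mapping.lookup m v)"
    using assms m by (simp add: homogeneous_def)
  then show "bihomogeneous (n, 0) (Const (Poly_Mapping.lookup p m) *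
      (\<Prod>v\<in>UNIV. (Var (Inl v) :: 'a A) ^ Poly_Mapping.lookup m v))"
    using bihomogeneous_mult[OF bihomogeneous_Const] by fastforce
qed

definition bigraded_part :: "nat \<times> nat \<Rightarrow> 'k::field A \<Rightarrow> 'k A"
  where "bigraded_part e p =
    (\<Sum>m | m \<in> Poly_Mapping.keys p \<and> bidegree m = e. Poly_Mapping.single m (Poly_Mapping.lookup p m))"

lemma lookup_bigraded_part:
  "Poly_Mapping.lookup (bigraded_part e p) m = (if bidegree m = e then Poly_Mapping.lookup p m else 0)"
  by (simp add: bigraded_part_def lookup_sum lookup_single when_def in_keys_iff)

lemma bihomogeneous_bigraded_part: "bihomogeneous e (bigraded_part e p)"
  by (auto simp: bihomogeneous_iff in_keys_iff lookup_bigraded_part split: if_splits)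

lemma bigraded_part_bihomogeneous:
  assumes "bihomogeneous e p"
  shows "bigraded_part e' p = (if e' = e then p else 0)"
  by (rule poly_mapping_eqI)
    (use assms in \<open>auto simp: lookup_bigraded_part bihomogeneous_iff in_keys_iff\<close>)

lemma bigraded_part_add: "bigraded_part e (p + q) = bigraded_part e p + bigraded_part e q"
  by (rule poly_mapping_eqI) (simp add: lookup_bigraded_part lookup_add)

text \<open>
  The case distinction is forced by the truncated subtraction of natural numbers: a multiple of \<open>g\<close>
  has a nonzero part only in bidegrees that are at least the one of \<open>g\<close> in both entries.
\<close>

lemma bigraded_part_mult:
  assumes "bihomogeneous (a, b) g"
  shows "bigraded_part (i, j) (q * g) =
    (if a \<le> i \<and> b \<le> j then bigraded_part (i - a, j - b) q * g else 0)"
proof (induction q rule: mpoly_induct)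
  case (single m c)
  obtain s t where st: "bidegree m = (s, t)"
    by (cases "bidegree m")
  have 1: "bihomogeneous (s + a, t + b) (Poly_Mapping.single m c * g)"
    using bihomogeneous_mult[OF bihomogeneous_single assms, of m c] by (simp add: st)
  have 2: "bihomogeneous (s, t) (Poly_Mapping.single m c)"
    using bihomogeneous_single[of m c] by (simp add: st)
  show ?case
    by (auto simp: bigraded_part_bihomogeneous[OF 1] bigraded_part_bihomogeneous[OF 2])
qed (simp add: distrib_right bigraded_part_add)

lemma Var_mult_eq_0:
  assumes "Var v * (p :: ('v, 'k::field) mpoly) = 0"
  shows "p = 0"
proof (rule poly_mapping_eqI)
  fix n
  have "Poly_Mapping.lookup (Var v * p) (Poly_Mapping.single v 1 + n) = Poly_Mapping.lookup p n"
    by (induction p rule: mpoly_induct)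
      (simp_all add: Var_def mult_single lookup_single when_def lookup_add distrib_left)
  with assms show "Poly_Mapping.lookup p n = Poly_Mapping.lookup 0 n"
    by simp
qed


section \<open>Order of vanishing along \<open>x\<^sub>0 = x\<^sub>1 = 0\<close>\<close>

text \<open>
  The substitution \<open>x\<^sub>0 \<mapsto> s x\<^sub>0\<close>, \<open>x\<^sub>1 \<mapsto> s x\<^sub>1\<close> into \<open>R[s]\<close>. A polynomial lies in \<open>(x\<^sub>0, x\<^sub>1)\<^sup>n\<close> if and
  only if its image is divisible by \<open>s\<^sup>n\<close>, so the order of vanishing along \<open>x\<^sub>0 = x\<^sub>1 = 0\<close> is the
  multiplicity of the root \<open>s = 0\<close>.
\<close>

definition stretch :: "'k::field R \<Rightarrow> 'k R poly"
  where "stretch = mpoly_eval (\<lambda>a. [:Const a:]) (\<lambda>i. if i = 3 then [:Var 3:] else Polynomial.monom (Var i) 1)"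

interpretation stretch: ring_morphism stretch
  unfolding stretch_def by (intro ring_morphism_mpoly_eval ring_morphism_const_poly ring_morphism_Const)

lemma stretch_monomial:
  "stretch (Const k * rx0 ^ a * rx1 ^ b * rx2 ^ c) =
    Polynomial.monom (Const k * rx0 ^ a * rx1 ^ b * rx2 ^ c) (a + b)"
proof -
  note c = ring_morphism_const_poly[OF ring_morphism_Const]
  have "stretch (Const k :: 'a R) = Polynomial.monom (Const k) 0" "stretch (rx0 :: 'a R) = Polynomial.monom rx0 1"
    "stretch (rx1 :: 'a R) = Polynomial.monom rx1 1" "stretch (rx2 :: 'a R) = Polynomial.monom rx2 0"
    by (simp_all add: stretch_def mpoly_eval_Const[OF c] mpoly_eval_Var[OF c] monom_0)
  then show ?thesis
    by (simp add: stretch.mult stretch.power monom_power mult_monom)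
qed

lemma R_monomial_eq_single:
  "Const k * rx0 ^ a * rx1 ^ b * rx2 ^ c = Poly_Mapping.single
    (Poly_Mapping.single 1 a + Poly_Mapping.single 2 b + Poly_Mapping.single 3 c) k"
  by (simp add: Var_power Const_def mult_single)

lemma lookup_coeff_stretch:
  "Poly_Mapping.lookup (coeff (stretch p) i) m =
    (if i = Poly_Mapping.lookup m 1 + Poly_Mapping.lookup m 2 then Poly_Mapping.lookup p m else 0)"
proof (induction p rule: R_induct)
  case (monomial k a b c)
  show ?case
    unfolding stretch_monomial unfolding R_monomial_eq_single
    by (auto simp: coeff_monom lookup_single when_def lookup_add)
qed (simp_all add: stretch.add lookup_add)

definition vanishes :: "nat \<Rightarrow> 'k::field R \<Rightarrow> bool"
  where "vanishes n p \<longleftrightarrow> Polynomial.monom 1 n dvd stretch p"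

lemma vanishes_0: "vanishes 0 p"
  by (simp add: vanishes_def monom_1_dvd_iff')

lemma vanishes_zero: "vanishes n 0"
  by (simp add: vanishes_def stretch.zero)

lemma vanishes_le: "vanishes n p \<Longrightarrow> k \<le> n \<Longrightarrow> vanishes k p"
  by (auto simp: vanishes_def monom_1_dvd_iff')

lemma vanishes_add: "vanishes n p \<Longrightarrow> vanishes n q \<Longrightarrow> vanishes n (p + q)"
  by (simp add: vanishes_def stretch.add)

lemma vanishes_diff: "vanishes n p \<Longrightarrow> vanishes n q \<Longrightarrow> vanishes n (p - q)"
  by (simp add: vanishes_def stretch.diff)

lemma vanishes_mult: "vanishes i p \<Longrightarrow> vanishes j q \<Longrightarrow> vanishes (i + j) (p * q)"
  unfolding vanishes_def stretch.mult
  by (metis mult_dvd_mono mult_monom mult_1)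

lemma vanishes_monomial: "n \<le> a + b \<Longrightarrow> vanishes n (Const k * rx0 ^ a * rx1 ^ b * rx2 ^ c)"
  unfolding vanishes_def stretch_monomial monom_1_dvd_iff' by (simp add: coeff_monom)

lemma vanishes_lookup:
  "vanishes n p \<Longrightarrow> m \<in> Poly_Mapping.keys p \<Longrightarrow> n \<le> Poly_Mapping.lookup m 1 + Poly_Mapping.lookup m 2"
  unfolding vanishes_def monom_1_dvd_iff'
  by (metis in_keys_iff lookup_coeff_stretch lookup_zero not_le)

text \<open>
  The order is a valuation, because the multiplicity of a root is additive over a domain. So if \<open>q\<close>
  vanishes to order at most \<open>j\<close>, then it accounts for at most \<open>j\<close> of the order of \<open>p * q\<close>.
\<close>

lemma vanishes_cancel:
  assumes "vanishes (i + j) (p * q)" "\<not> vanishes (Suc j) q"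
  shows "vanishes i p"
proof (cases "stretch p = 0")
  case False
  have q: "stretch q \<noteq> 0"
    using assms(2) by (auto simp: vanishes_def)
  show ?thesis
    using assms False q unfolding vanishes_def stretch.mult
    by (simp add: monom_1_dvd_iff order_mult)
qed (simp add: vanishes_def)


section \<open>Parametrization of the hypersurface \<open>x\<^sub>0 y\<^sub>0 = x\<^sub>1 y\<^sub>1\<close>\<close>

text \<open>
  The coefficients of the outer polynomials belong to powers of \<open>y\<^sub>2\<close>, those of the inner
  polynomials to powers of \<open>w\<close>; so \<open>coeff (coeff Q l) k\<close> is the coefficient of \<open>Q\<close>
  at \<open>w\<^sup>k y\<^sub>2\<^sup>l\<close>.
\<close>

definition param :: "'k::field A \<Rightarrow> 'k R poly poly"
  where "param = mpoly_eval (\<lambda>a. [:[:Const a:]:]) (\<lambda>v. case v of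
      Inl i \<Rightarrow> [:[:Var i:]:]
    | Inr j \<Rightarrow> if j = 1 then [:Polynomial.monom rx1 1:]
        else if j = 2 then [:Polynomial.monom rx0 1:] else Polynomial.monom 1 1)"

lemma param_coefficients: "ring_morphism (\<lambda>a. [:[:Const a :: 'k::field R:]:])"
  by (intro ring_morphism_const_poly ring_morphism_Const)

interpretation param: ring_morphism param
  unfolding param_def by (intro ring_morphism_mpoly_eval param_coefficients)

lemma param_simps:
  "param (Const a) = [:[:Const a:]:]"
  "param (Var (Inl i)) = [:[:Var i:]:]"
  "param y0 = [:Polynomial.monom rx1 1:]"
  "param y1 = [:Polynomial.monom rx0 1:]"
  "param y2 = Polynomial.monom 1 1"
  by (simp_all add: param_def mpoly_eval_Const[OF param_coefficients] mpoly_eval_Var[OF param_coefficients])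

lemma param_R_to_A: "param (R_to_A p) = [:[:p:]:]"
proof -
  have "param (R_to_A p) = mpoly_eval (\<lambda>a. [:[:Const a:]:]) (\<lambda>i. [:[:Var i:]:]) p"
    by (simp add: R_to_A_def param.mpoly_eval param_simps)
  also have "\<dots> = [:[:mpoly_eval Const Var p:]:]"
    by (rule ring_morphism.mpoly_eval[symmetric]) (intro ring_morphism_const_poly ring_morphism_id)
  finally show ?thesis
    by (simp add: mpoly_eval_Const_Var)
qed

lemma param_monomial:
  "param (Const k * x0 ^ a * x1 ^ b * Var (Inl 3) ^ c * y0 ^ d * y1 ^ e * y2 ^ f) =
    Polynomial.monom (Polynomial.monom (Const k * rx0 ^ (a + e) * rx1 ^ (b + d) * rx2 ^ c) (d + e)) f"
  by (simp add: param.mult param.power param_simps poly_const_pow monom_power mult_monom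
      smult_monom power_add mult_ac flip: monom_0)

text \<open>
  The equation of the Segre embedding of \<open>P\<^sup>1 \<times> P\<^sup>1\<close>, up to the naming of the coordinates.
\<close>

definition segre_form :: "'k::field A"
  where "segre_form = x0 * y0 - x1 * y1"

lemma param_segre_form: "param segre_form = 0"
  by (simp add: segre_form_def param.diff param.mult param_simps mult_monom smult_monom mult.commute flip: monom_0)

definition linear_extension :: "(('v \<Rightarrow>\<^sub>0 nat) \<Rightarrow> ('u, 'k) mpoly) \<Rightarrow> ('v, 'k::field) mpoly \<Rightarrow> ('u, 'k) mpoly"
  where "linear_extension f p = (\<Sum>m\<in>Poly_Mapping.keys p. Const (Poly_Mapping.lookup p m) * f m)"

lemma linear_extension_superset:
  assumes "finite K" "Poly_Mapping.keys p \<subseteq> K"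
  shows "linear_extension f p = (\<Sum>m\<in>K. Const (Poly_Mapping.lookup p m) * f m)"
  unfolding linear_extension_def
  by (rule sum.mono_neutral_left) (use assms in \<open>auto simp: in_keys_iff Const.zero\<close>)

lemma linear_extension_add: "linear_extension f (p + q) = linear_extension f p + linear_extension f q"
proof -
  let ?K = "Poly_Mapping.keys p \<union> Poly_Mapping.keys q"
  have "Poly_Mapping.keys (p + q) \<subseteq> ?K"
    by (rule keys_add)
  then show ?thesis
    by (subst (1 2 3) linear_extension_superset[of ?K])
      (auto simp: lookup_add Const.add distrib_right sum.distrib)
qed

lemma linear_extension_single: "linear_extension f (Poly_Mapping.single m a) = Const a * f m"
  by (simp add: linear_extension_def Const.zero)

lemma linear_extension_0: "linear_extension f 0 = 0"
  by (simp add: linear_extension_def)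

definition poly_sum :: "(nat \<Rightarrow> 'a::zero \<Rightarrow> 'b) \<Rightarrow> 'a poly \<Rightarrow> 'b::comm_monoid_add"
  where "poly_sum f p = (\<Sum>i\<le>degree p. f i (coeff p i))"

lemma poly_sum_bound:
  assumes "degree p \<le> N" "\<And>i. f i 0 = 0"
  shows "poly_sum f p = (\<Sum>i\<le>N. f i (coeff p i))"
  unfolding poly_sum_def
  by (rule sum.mono_neutral_left) (use assms in \<open>auto simp: coeff_eq_0\<close>)

lemma poly_sum_add:
  assumes "\<And>i. f i 0 = 0" "\<And>i a b. f i (a + b) = f i a + f i b"
  shows "poly_sum f (p + q) = poly_sum f p + poly_sum f q"
proof -
  have "degree (p + q) \<le> max (degree p) (degree q)"
    by (rule degree_add_le_max)
  then show ?thesis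
    by (subst (1 2 3) poly_sum_bound[where N = "max (degree p) (degree q)"])
      (simp_all add: assms sum.distrib)
qed

lemma poly_sum_monom:
  assumes "\<And>i. f i 0 = 0"
  shows "poly_sum f (Polynomial.monom a n) = f n a"
proof -
  have "poly_sum f (Polynomial.monom a n) = (\<Sum>i\<le>n. f i (coeff (Polynomial.monom a n) i))"
    by (rule poly_sum_bound) (simp_all add: assms degree_monom_le)
  also have "\<dots> = (\<Sum>i\<le>n. if i = n then f n a else 0)"
    by (rule sum.cong) (auto simp: coeff_monom assms)
  finally show ?thesis
    by simp
qed

lemma poly_sum_0: "(\<And>i. f i 0 = 0) \<Longrightarrow> poly_sum f 0 = 0"
  by (simp add: poly_sum_def)

text \<open>
  A preimage of \<open>x\<^sup>m w\<^sup>k y\<^sub>2\<^sup>l\<close> under \<^const>\<open>param\<close>, if there is one: as many factors \<open>w\<close> as possible are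
  combined with \<open>x\<^sub>0\<close> to \<open>y\<^sub>1\<close>, which accounts for \<open>k - (k - a) = min a k\<close> of them, the remaining \<open>k - a\<close>
  with \<open>x\<^sub>1\<close> to \<open>y\<^sub>0\<close>. The exponent of \<open>x\<^sub>1\<close> is truncated if and only if the degree in \<open>x\<^sub>0, x\<^sub>1\<close> is less
  than \<open>k\<close>, that is, if there is no preimage.
\<close>

definition toric_monomial :: "nat \<Rightarrow> nat \<Rightarrow> (3 \<Rightarrow>\<^sub>0 nat) \<Rightarrow> 'k::field A"
  where "toric_monomial l k m = (let a = Poly_Mapping.lookup m 1; b = Poly_Mapping.lookup m 2 in
    x0 ^ (a - k) * x1 ^ (b - (k - a)) * Var (Inl 3) ^ Poly_Mapping.lookup m 3 *
    y0 ^ (k - a) * y1 ^ (k - (k - a)) * y2 ^ l)"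

definition toric_section :: "'k::field R poly poly \<Rightarrow> 'k A"
  where "toric_section = poly_sum (\<lambda>l. poly_sum (\<lambda>k. linear_extension (toric_monomial l k)))"

lemma toric_section_add: "toric_section (P + Q) = toric_section P + toric_section Q"
  unfolding toric_section_def by (intro poly_sum_add poly_sum_0 linear_extension_0 linear_extension_add)

lemma toric_section_monom:
  "toric_section (Polynomial.monom (Polynomial.monom p k) l) = linear_extension (toric_monomial l k) p"
  unfolding toric_section_def by (simp add: poly_sum_monom poly_sum_0 linear_extension_0)

text \<open>
  The section is additive, so monomials suffice. The section of the image of a monomial is the
  monomial in which \<open>(x\<^sub>0 y\<^sub>0)\<^sup>j\<close> has been replaced by \<open>(x\<^sub>1 y\<^sub>1)\<^sup>j\<close> with \<open>j\<close> as large as possible, which is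
  congruent to it modulo the binomial.
\<close>

lemma segre_form_dvd_toric_section_param: "segre_form dvd toric_section (param q) - q"
proof (induction q rule: A_induct)
  case (monomial k a b c d e f)
  define j where "j = min a d"
  define r where "r = Const k * x0 ^ (a - d) * x1 ^ b * Var (Inl 3) ^ c * y0 ^ (d - a) * y1 ^ e * (y2 :: 'a A) ^ f"
  have "toric_section (param (Const k * x0 ^ a * x1 ^ b * Var (Inl 3) ^ c * y0 ^ d * y1 ^ e * y2 ^ f)) =
    Const k * (x0 ^ (a - d) * x1 ^ (b + d - (d - a)) * Var (Inl 3) ^ c *
      y0 ^ (d - a) * y1 ^ (d + e - (d - a)) * y2 ^ f)"
    unfolding param_monomial toric_section_monom R_monomial_eq_single linear_extension_single
    by (simp add: toric_monomial_def lookup_add lookup_single when_def)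
  also have "\<dots> = Const k * (x0 ^ (a - d) * x1 ^ (b + j) * Var (Inl 3) ^ c * y0 ^ (d - a) * y1 ^ (e + j) * y2 ^ f)"
  proof -
    have "b + d - (d - a) = b + j" "d + e - (d - a) = e + j"
      by (auto simp: j_def)
    then show ?thesis by simp
  qed
  also have "Const k * (x0 ^ (a - d) * x1 ^ (b + j) * Var (Inl 3) ^ c * y0 ^ (d - a) * y1 ^ (e + j) * y2 ^ f) =
      r * (x1 * y1) ^ j"
    by (simp add: r_def power_add power_mult_distrib mult_ac)
  finally have 1: "toric_section (param (Const k * x0 ^ a * x1 ^ b * Var (Inl 3) ^ c * y0 ^ d * y1 ^ e * y2 ^ f)) =
      r * (x1 * y1) ^ j" .
  have "a = a - d + j" "d = d - a + j"
    by (auto simp: j_def)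
  then have "(x0 :: 'a A) ^ a = x0 ^ (a - d) * x0 ^ j" "(y0 :: 'a A) ^ d = y0 ^ (d - a) * y0 ^ j"
    by (metis power_add)+
  then have 2: "Const k * x0 ^ a * x1 ^ b * Var (Inl 3) ^ c * y0 ^ d * y1 ^ e * y2 ^ f = r * (x0 * y0) ^ j"
    by (simp add: r_def power_mult_distrib mult_ac)
  have "x0 * y0 - x1 * y1 dvd (x0 * y0) ^ j - (x1 * y1 :: 'a A) ^ j"
    unfolding power_diff_sumr2[of "x0 * y0" j] by (rule dvd_triv_left)
  then have "segre_form dvd (x1 * y1) ^ j - (x0 * y0 :: 'a A) ^ j"
    by (subst dvd_minus_iff[symmetric]) (simp add: segre_form_def)
  then show ?case
    unfolding 2 unfolding 1[unfolded 2] right_diff_distrib[symmetric] by (rule dvd_mult)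
next
  case (add p q)
  then show ?case
    using dvd_add[OF add] by (simp add: param.add toric_section_add algebra_simps)
qed

text \<open>
  The kernel of the parametrization, immediate from the existence of a section modulo the binomial.
\<close>

lemma param_eq_0_iff: "param q = 0 \<longleftrightarrow> segre_form dvd q"
proof
  assume "param q = 0"
  then show "segre_form dvd q"
    using segre_form_dvd_toric_section_param[of q] by (simp add: toric_section_def poly_sum_0 linear_extension_0)
next
  assume "segre_form dvd q"
  then show "param q = 0"
    by (auto simp: dvd_def param.mult param_segre_form)
qed

lemma vanishes_coeff_param: "vanishes k (coeff (coeff (param q) l) k)"
proof (induction q rule: A_induct)
  case (monomial k a b c d e f)
  show ?case
    unfolding param_monomial by (auto simp: coeff_monom vanishes_zero intro!: vanishes_monomial)
qed (simp add: param.add vanishes_add)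

lemma param_toric_monomial:
  assumes "k \<le> Poly_Mapping.lookup m 1 + Poly_Mapping.lookup m 2"
  shows "param (Const a * toric_monomial l k m) =
    Polynomial.monom (Polynomial.monom (Poly_Mapping.single m a) k) l"
proof -
  have e: "Poly_Mapping.lookup m 1 - k + (k - (k - Poly_Mapping.lookup m 1)) = Poly_Mapping.lookup m 1"
    "Poly_Mapping.lookup m 2 - (k - Poly_Mapping.lookup m 1) + (k - Poly_Mapping.lookup m 1) = Poly_Mapping.lookup m 2"
    "k - Poly_Mapping.lookup m 1 + (k - (k - Poly_Mapping.lookup m 1)) = k"
    using assms by auto
  show ?thesis
    unfolding toric_monomial_def Let_def mult.assoc[symmetric] param_monomial e
    by (simp only: single_eq_Const_Var[of m a] prod_UNIV_3 mult.assoc)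
qed

lemma param_toric_section:
  assumes "\<And>k l. vanishes k (coeff (coeff Q l) k)"
  shows "param (toric_section Q) = Q"
proof -
  have "param (linear_extension (toric_monomial l k) (coeff (coeff Q l) k)) =
      Polynomial.monom (Polynomial.monom (coeff (coeff Q l) k) k) l" for k l
  proof -
    have "param (linear_extension (toric_monomial l k) (coeff (coeff Q l) k)) =
        (\<Sum>m\<in>Poly_Mapping.keys (coeff (coeff Q l) k).
          Polynomial.monom (Polynomial.monom (Poly_Mapping.single m (Poly_Mapping.lookup (coeff (coeff Q l) k) m)) k) l)"
      unfolding linear_extension_def param.sum
      by (intro sum.cong refl param_toric_monomial vanishes_lookup[OF assms])
    also have "\<dots> = Polynomial.monom (Polynomial.monom (coeff (coeff Q l) k) k) l"
      unfolding monom_sum[symmetric] by (simp add: poly_mapping_sum_single[symmetric])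
    finally show ?thesis .
  qed
  then show ?thesis
    unfolding toric_section_def poly_sum_def param.sum
    by (simp add: monom_sum[symmetric] poly_as_sum_of_monoms)
qed

text \<open>
  If a monomial has more factors \<open>x\<^sub>0, x\<^sub>1\<close> than factors \<open>w\<close>, then one of the former is left over in
  \<^const>\<open>toric_monomial\<close>. This detects membership in \<open>(x\<^sub>0, x\<^sub>1)\<close>, the loop condition of the algorithm,
  from the image in \<open>T\<close>.
\<close>

lemma toric_section_in_x0_x1:
  assumes "\<And>k l. vanishes (Suc k) (coeff (coeff Q l) k)"
  shows "toric_section Q \<in> ideal_span {x0, x1}"
proof -
  have "toric_monomial l k m \<in> ideal_span {x0, x1 :: 'a A}"
    if "Suc k \<le> Poly_Mapping.lookup m 1 + Poly_Mapping.lookup m 2" for l k m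
  proof -
    have *: "(x :: 'a A) ^ n * z \<in> ideal_span {x0, x1}" if "n > 0" "x \<in> {x0, x1}" for x z n
    proof -
      have "x ^ n * z = (x ^ (n - 1) * z) * x"
        using \<open>n > 0\<close> by (cases n) (simp_all add: mult_ac)
      then show ?thesis
        using ideal.span_scale[OF ideal.span_base[OF that(2)], of "x ^ (n - 1) * z"] by simp
    qed
    show ?thesis
    proof (cases "Poly_Mapping.lookup m 1 > k")
      case True
      then show ?thesis
        unfolding toric_monomial_def Let_def mult.assoc by (intro *) auto
    next
      case False
      then have "Poly_Mapping.lookup m 2 - (k - Poly_Mapping.lookup m 1) > 0"
        using that by simp
      then show ?thesis
        unfolding toric_monomial_def Let_def mult.assoc
        by (intro ideal.span_scale *) auto
    qed
  qed
  then show ?thesis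
    unfolding toric_section_def poly_sum_def linear_extension_def
    by (intro ideal.span_sum ideal.span_scale) (use vanishes_lookup[OF assms] in blast)
qed


section \<open>Consequences of the Hilbert--Burch presentation\<close>

lemma Var_neq_0: "(Var v :: ('v, 'k::field) mpoly) \<noteq> 0"
  using Var_mult_eq_0[of v "1 :: ('v, 'k) mpoly"] by auto

text \<open>
  Setting \<open>x\<^sub>0\<close> to zero is a ring homomorphism that keeps \<open>x\<^sub>1\<close> nonzero, and every polynomial is
  congruent modulo \<open>x\<^sub>0\<close> to its image.
\<close>

lemma rx0_dvd_rx1_mult_imp_dvd:
  assumes "rx0 dvd rx1 * p"
  shows "rx0 dvd (p :: 'k::field R)"
proof -
  define s where "s = (\<lambda>i::3. if i = 1 then 0 else Var i :: 'k R)"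
  define h where "h = mpoly_eval Const s"
  interpret h: ring_morphism h
    unfolding h_def by (rule ring_morphism_mpoly_eval[OF ring_morphism_Const])
  have V: "h (Var i) = s i" for i
    unfolding h_def by (rule mpoly_eval_Var[OF ring_morphism_Const])
  have C: "h (Const a) = Const a" for a
    unfolding h_def by (rule mpoly_eval_Const[OF ring_morphism_Const])
  have *: "rx0 dvd q - h q" for q
  proof (induction q rule: R_induct)
    case (monomial k a b c)
    show ?case
      by (cases "a = 0") (simp_all add: h.mult h.power V C s_def power_0_left)
  next
    case (add p q)
    then show ?case
      using dvd_add[OF add] by (simp add: h.add algebra_simps)
  qed
  from assms obtain q where "rx1 * p = rx0 * q"
    by (rule dvdE)
  then have "h (rx1 * p) = h (rx0 * q)"
    by simp
  then have "rx1 * h p = 0"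
    by (simp add: h.mult V s_def)
  then have "h p = 0"
    by (simp add: Var_neq_0)
  with *[of p] show ?thesis
    by simp
qed

lemma homogeneous_eval_0:
  assumes "homogeneous n p" "n > 0"
  shows "mpoly_eval (\<lambda>a. a) (\<lambda>_. 0) p = (0 :: 'k::field)"
  unfolding mpoly_eval_def
proof (rule sum.neutral, rule ballI)
  fix m assume "m \<in> Poly_Mapping.keys p"
  then have "(\<Sum>v\<in>UNIV. Poly_Mapping.lookup m v) \<noteq> 0"
    using assms by (simp add: homogeneous_def)
  then obtain v where "Poly_Mapping.lookup m v \<noteq> 0"
    by (meson sum.neutral)
  then have "(\<Prod>v\<in>UNIV. (0::'k) ^ Poly_Mapping.lookup m v) = 0"
    by (intro prod_zero) (auto intro!: bexI[of _ v])
  then show "Poly_Mapping.lookup p m * (\<Prod>v\<in>UNIV. (0::'k) ^ Poly_Mapping.lookup m v) = 0"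
    by simp
qed

lemma ring_morphism_poly_map_poly:
  assumes "ring_morphism h"
  shows "ring_morphism (\<lambda>p. poly (map_poly h p) x)"
proof
  interpret h: ring_morphism h by (rule assms)
  have add: "poly (map_poly h (p + q)) x = poly (map_poly h p) x + poly (map_poly h q) x" for p q
  proof -
    have "map_poly h (p + q) = map_poly h p + map_poly h q"
      by (rule poly_eqI) (simp add: coeff_map_poly h.zero h.add)
    then show ?thesis by simp
  qed
  have pCons: "map_poly h (pCons a p) = pCons (h a) (map_poly h p)" for a p
    by (rule poly_eqI) (simp add: coeff_map_poly h.zero coeff_pCons split: nat.split)
  have smult: "map_poly h (Polynomial.smult a p) = Polynomial.smult (h a) (map_poly h p)" for a p
    by (rule poly_eqI) (simp add: coeff_map_poly h.zero h.mult)
  show "poly (map_poly h (p + q)) x = poly (map_poly h p) x + poly (map_poly h q) x" for p q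
    by (rule add)
  show "poly (map_poly h (p * q)) x = poly (map_poly h p) x * poly (map_poly h q) x" for p q
    by (induction p) (simp_all add: add pCons smult h.zero algebra_simps)
  show "poly (map_poly h 1) x = 1"
    by (simp add: h.one)
qed

lemma ring_morphism_pcompose: "ring_morphism (\<lambda>p. pcompose p q)"
  by unfold_locales (simp_all add: pcompose_add pcompose_mult pcompose_1)

text \<open>
  Each step of the division by \<open>a + b Y\<close> costs one factor \<open>b\<close>, which takes the place of dividing by
  the leading coefficient.
\<close>

lemma pseudo_division_linear:
  fixes a b :: "'a::comm_ring_1"
  shows "\<exists>N E r. Polynomial.smult (b ^ N) Q = [:a, b:] * E + [:r:]"
proof (induction Q)
  case 0
  have "Polynomial.smult (b ^ 0) 0 = [:a, b:] * 0 + [:0:]"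
    by simp
  then show ?case by blast
next
  case (pCons c Q)
  then obtain N E r where NEr: "Polynomial.smult (b ^ N) Q = [:a, b:] * E + [:r:]"
    by blast
  have "Polynomial.smult (b ^ Suc N) (pCons c Q) =
      [:b ^ Suc N * c:] + [:0, b:] * Polynomial.smult (b ^ N) Q"
    by (simp add: mult.commute)
  also have "\<dots> = [:a, b:] * ([:0, b:] * E + [:r:]) + [:b ^ Suc N * c - a * r:]"
    unfolding NEr by (simp add: algebra_simps)
  finally show ?case by blast
qed

text \<open>
  What is used of the presentation, with \<open>f\<^sub>0 = x\<^sub>1 h\<close> and \<open>f\<^sub>1 = x\<^sub>0 h\<close> already inserted: the second column
  of the matrix is a syzygy, the two columns generate all syzygies and are linearly
  independent. The last condition, that \<open>p\<^sub>0\<close> has no constant term, prevents \<open>f\<^sub>0\<close> from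
  being zero.
\<close>

locale linear_syzygy_presentation =
  fixes h f2 p0 p1 p2 :: "'k::field R"
  assumes second_syzygy: "h * (rx1 * p0 + rx0 * p1) + f2 * p2 = 0"
    and exact: "rx1 * h * u0 + rx0 * h * u1 + f2 * u2 = 0 \<Longrightarrow>
      \<exists>a b. u0 = a * rx0 + b * p0 \<and> u1 = b * p1 - a * rx1 \<and> u2 = b * p2"
    and independent: "a * rx0 + b * p0 = 0 \<Longrightarrow> b * p1 - a * rx1 = 0 \<Longrightarrow> b * p2 = 0 \<Longrightarrow> a = 0 \<and> b = 0"
    and p0_eval_0: "mpoly_eval (\<lambda>a. a) (\<lambda>_. 0) p0 = 0"
begin

definition alpha where "alpha = rx1 * p0 + rx0 * p1"

text \<open>
  Otherwise \<open>(1, 0, 0)\<close> would be a syzygy, and \<open>1\<close> a combination of \<open>x\<^sub>0\<close> and \<open>p\<^sub>0\<close>; but both have no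
  constant term.
\<close>

lemma h_nonzero: "h \<noteq> 0"
proof
  interpret e: ring_morphism "mpoly_eval (\<lambda>a. a) (\<lambda>_. 0 :: 'k) :: 'k R \<Rightarrow> 'k"
    by (rule ring_morphism_mpoly_eval[OF ring_morphism_id])
  assume "h = 0"
  then have "rx1 * h * 1 + rx0 * h * 0 + f2 * 0 = 0"
    by simp
  then obtain a b where "1 = a * rx0 + b * p0"
    using exact by blast
  then have "mpoly_eval (\<lambda>a. a) (\<lambda>_. 0) (1 :: 'k R) = mpoly_eval (\<lambda>a. a) (\<lambda>_. 0) (a * rx0 + b * p0)"
    by simp
  then show False
    unfolding e.one e.add e.mult p0_eval_0 mpoly_eval_Var[OF ring_morphism_id] by simp
qed

lemma h_alpha: "h * alpha + f2 * p2 = 0"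
  using second_syzygy unfolding alpha_def .

text \<open>
  Otherwise \<open>x\<^sub>0\<close> times the second column would equal \<open>p\<^sub>0\<close> times the first one.
\<close>

lemma alpha_nonzero: "p2 = 0 \<Longrightarrow> alpha \<noteq> 0"
proof
  assume "p2 = 0" "alpha = 0"
  then have "(- p0) * rx0 + rx0 * p0 = 0" "rx0 * p1 - (- p0) * rx1 = 0" "rx0 * p2 = 0"
    by (simp_all add: alpha_def algebra_simps)
  then show False
    using independent[of "- p0" rx0] Var_neq_0 by metis
qed

lemma p2_nonzero: "p2 \<noteq> 0"
  using h_alpha alpha_nonzero h_nonzero by auto

text \<open>
  From \<open>p\<^sub>2 a = \<alpha> b\<close> one obtains the two syzygies \<open>(0, a, x\<^sub>0 b)\<close> and \<open>(a, 0, x\<^sub>1 b)\<close>. Their expressions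
  by the columns contain the second column \<open>B\<close> and \<open>B'\<close> times, where \<open>B p\<^sub>2 = x\<^sub>0 b\<close> and
  \<open>B' p\<^sub>2 = x\<^sub>1 b\<close>; so \<open>x\<^sub>1 B = x\<^sub>0 B'\<close>, and \<open>B = x\<^sub>0 c\<close> yields the common cofactor \<open>c\<close>.
\<close>

lemma coprime_alpha_p2:
  assumes "p2 * a = alpha * b"
  shows "\<exists>c. a = c * alpha \<and> b = c * p2"
proof -
  have 0: "h * a + f2 * b = 0"
  proof -
    have "p2 * (h * a + f2 * b) = (h * alpha + f2 * p2) * b"
      using assms by (simp add: algebra_simps)
    then show ?thesis
      using p2_nonzero by (simp add: h_alpha)
  qed
  have "rx1 * h * 0 + rx0 * h * a + f2 * (b * rx0) = rx0 * (h * a + f2 * b)"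
    by (simp add: algebra_simps)
  then have "rx1 * h * 0 + rx0 * h * a + f2 * (b * rx0) = 0"
    unfolding 0 by simp
  from exact[OF this] obtain A B where AB: "a = B * p1 - A * rx1" "b * rx0 = B * p2"
    by blast
  have "rx1 * h * a + rx0 * h * 0 + f2 * (b * rx1) = rx1 * (h * a + f2 * b)"
    by (simp add: algebra_simps)
  then have "rx1 * h * a + rx0 * h * 0 + f2 * (b * rx1) = 0"
    unfolding 0 by simp
  from exact[OF this] obtain A' B' where AB': "a = A' * rx0 + B' * p0" "b * rx1 = B' * p2"
    by blast
  have "p2 * (rx1 * B - rx0 * B') = rx1 * (B * p2) - rx0 * (B' * p2)"
    by (simp add: algebra_simps)
  also have "\<dots> = 0"
    unfolding AB(2)[symmetric] AB'(2)[symmetric] by (simp add: algebra_simps)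
  finally have "p2 * (rx1 * B - rx0 * B') = 0" .
  then have "rx1 * B = rx0 * B'"
    using p2_nonzero by simp
  then have "rx0 dvd rx1 * B" ..
  then have "rx0 dvd B"
    by (rule rx0_dvd_rx1_mult_imp_dvd)
  then obtain C where C: "B = rx0 * C" ..
  have "rx0 * (b - C * p2) = b * rx0 - B * p2"
    unfolding C by (simp add: algebra_simps)
  then have "rx0 * (b - C * p2) = 0"
    unfolding AB(2) by simp
  then have b: "b - C * p2 = 0"
    by (rule Var_mult_eq_0)
  then have "p2 * (a - C * alpha) = 0"
    using assms by (simp add: algebra_simps)
  then show ?thesis
    using b p2_nonzero by auto
qed

definition G :: "'k R poly poly"
  where "G = [:Polynomial.monom alpha 1, [:p2:]:]"

lemma G_nonzero: "G \<noteq> 0"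
  using p2_nonzero by (simp add: G_def)

lemma coeff_G_mult:
  "coeff (coeff (G * E) l) k =
    (if k = 0 then 0 else alpha * coeff (coeff E l) (k - 1)) +
    (if l = 0 then 0 else p2 * coeff (coeff E (l - 1)) k)"
  by (cases k; cases l) (simp_all add: G_def coeff_pCons coeff_monom_mult)

text \<open>
  Modulo \<open>p\<^sub>2\<close> the polynomial \<open>G\<close> is \<open>\<alpha> w\<close>, and \<open>\<alpha>\<close> is regular modulo \<open>p\<^sub>2\<close> by coprimality; so \<open>p\<^sub>2\<close> divides
  each coefficient of \<open>E\<close> and can be cancelled.
\<close>

lemma G_dvd_cancel:
  assumes "[:[:p2:]:] * X = G * E"
  shows "G dvd X"
proof -
  have "p2 dvd coeff (coeff E l) k" for l k
  proof -
    have "p2 * coeff (coeff X l) (Suc k) = coeff (coeff (G * E) l) (Suc k)"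
      unfolding assms[symmetric] by simp
    also have "\<dots> = alpha * coeff (coeff E l) k +
        (if l = 0 then 0 else p2 * coeff (coeff E (l - 1)) (Suc k))"
      by (simp add: coeff_G_mult)
    finally have "p2 * (coeff (coeff X l) (Suc k) -
        (if l = 0 then 0 else coeff (coeff E (l - 1)) (Suc k))) = alpha * coeff (coeff E l) k"
      by (simp add: algebra_simps split: if_splits)
    from coprime_alpha_p2[OF this] show ?thesis
      by (auto simp: mult.commute)
  qed
  then have "[:[:p2:]:] dvd E"
    by (simp add: const_poly_dvd_iff)
  then obtain E' where "E = [:[:p2:]:] * E'" ..
  with assms have "[:[:p2:]:] * X = [:[:p2:]:] * (G * E')"
    by (simp add: mult.left_commute)
  then have "X = G * E'"
    using p2_nonzero by (subst (asm) mult_left_cancel) simp_all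
  then show ?thesis by simp
qed

lemma G_dvd_cancel_power:
  "G dvd [:[:p2:]:] ^ N * X \<Longrightarrow> G dvd X"
proof (induction N)
  case (Suc N)
  from Suc.prems obtain E where "[:[:p2:]:] ^ Suc N * X = G * E" ..
  then have "[:[:p2:]:] * ([:[:p2:]:] ^ N * X) = G * E"
    by (simp only: power_Suc mult.assoc)
  then have "G dvd [:[:p2:]:] ^ N * X"
    by (rule G_dvd_cancel)
  then show ?case
    by (rule Suc.IH)
qed simp

text \<open>
  The substitution \<open>w \<mapsto> h t\<close>, \<open>y\<^sub>2 \<mapsto> f\<^sub>2 t\<close> from \<open>T\<close> to \<open>R[t]\<close>.
\<close>

definition specialize :: "'k R poly poly \<Rightarrow> 'k R poly"
  where "specialize Q = poly (map_poly (\<lambda>p. pcompose p [:0, h:]) Q) [:0, f2:]"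

sublocale specialize: ring_morphism specialize
  unfolding specialize_def by (rule ring_morphism_poly_map_poly[OF ring_morphism_pcompose])

lemma specialize_const: "specialize [:p:] = pcompose p [:0, h:]"
  by (cases "p = 0") (simp_all add: specialize_def map_poly_pCons)

lemma specialize_y2: "specialize [:0, 1:] = [:0, f2:]"
  by (simp add: specialize_def map_poly_pCons pcompose_1)

lemma monom_1_eq: "Polynomial.monom a (Suc 0) = [:0, a:]"
  by (simp add: monom_Suc monom_0)

lemma specialize_G: "specialize G = 0"
proof -
  have "G = [:[:0, alpha:]:] + [:[:p2:]:] * [:0, 1:]"
    by (simp add: G_def monom_1_eq)
  then have "specialize G = [:0, h * alpha + f2 * p2:]"
    by (simp only: specialize.add specialize.mult specialize_const specialize_y2)
      (simp add: pcompose_pCons mult.commute)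
  then show ?thesis
    by (simp add: h_alpha)
qed

text \<open>
  Pseudo-division of \<open>Q\<close> by \<open>G\<close> leaves a remainder in \<open>R[w]\<close>, on which the substitution is injective because
  \<open>h \<noteq> 0\<close>. So \<open>G\<close> divides \<open>p\<^sub>2\<^sup>N Q\<close>, and \<open>p\<^sub>2\<close> cancels.
\<close>

lemma specialize_eq_0_imp_G_dvd:
  assumes "specialize Q = 0"
  shows "G dvd Q"
proof -
  obtain N E r where "Polynomial.smult ([:p2:] ^ N) Q = [:Polynomial.monom alpha 1, [:p2:]:] * E + [:r:]"
    using pseudo_division_linear by blast
  then have NEr: "[:[:p2:]:] ^ N * Q = G * E + [:r:]"
    by (simp add: G_def poly_const_pow)
  have "specialize ([:[:p2:]:] ^ N * Q) = specialize (G * E + [:r:])"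
    by (simp only: NEr)
  then have "pcompose r [:0, h:] = 0"
    by (simp add: specialize.mult specialize.add assms specialize_G specialize_const)
  then have "r = 0"
    by (rule pcompose_eq_0) (simp add: h_nonzero)
  with NEr have "G dvd [:[:p2:]:] ^ N * Q"
    by simp
  then show ?thesis
    by (rule G_dvd_cancel_power)
qed

lemma rees_map_eq: "rees_map (vector [rx1 * h, rx0 * h, f2]) q = specialize (param q)"
proof -
  have C: "specialize [:[:Const a:]:] = [:Const a:]" for a
    by (simp add: specialize_const)
  have V: "specialize (case v of Inl i \<Rightarrow> [:[:Var i:]:]
      | Inr j \<Rightarrow> if j = 1 then [:Polynomial.monom rx1 1:]
        else if j = 2 then [:Polynomial.monom rx0 1:] else Polynomial.monom 1 1) =
    (case v of Inl i \<Rightarrow> [:Var i:] | Inr j \<Rightarrow> Polynomial.monom (vector [rx1 * h, rx0 * h, f2] $ j) 1)" for v :: "3 + 3"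
  proof (cases v)
    case (Inr j)
    then show ?thesis
      using exhaust_3[of j]
      by (auto simp: specialize_const specialize_y2 monom_1_eq pcompose_pCons mult.commute)
  qed (simp add: specialize_const)
  show ?thesis
    unfolding param_def specialize.mpoly_eval rees_map_def C V ..
qed

lemma rees_ideal_eq: "rees_ideal (vector [rx1 * h, rx0 * h, f2]) I = {q. G dvd param q}"
proof -
  have "rees_ideal (vector [rx1 * h, rx0 * h, f2]) I = {q. rees_map (vector [rx1 * h, rx0 * h, f2]) q = 0}"
    by (simp add: rees_ideal_def a_kernel_def kernel_def rees_algebra_def cring_class_ops_def)
  also have "\<dots> = {q. G dvd param q}"
    using specialize_eq_0_imp_G_dvd by (auto simp: rees_map_eq dvd_def specialize.mult specialize_G)
  finally show ?thesis .
qed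

text \<open>
  Comparison of coefficients gives \<open>c\<^sub>k\<^sub>l = \<alpha> e\<^sub>k\<^sub>-\<^sub>1\<^sub>,\<^sub>l + p\<^sub>2 e\<^sub>k\<^sub>,\<^sub>l\<^sub>-\<^sub>1\<close>, where \<open>c\<^sub>k\<^sub>l\<close> vanishes to order \<open>k\<close>.
  One of \<open>p\<^sub>2\<close> and \<open>\<alpha>\<close> attains its minimal order exactly. The equation is solved for the
  entry of \<open>E\<close> that is multiplied by this one, whose order can then be cancelled; induction runs over \<open>k\<close> in the first
  case and over \<open>l\<close> in the second, so that the other entry of \<open>E\<close> is known from the induction hypothesis.
\<close>

lemma vanishes_cofactor:
  assumes "vanishes m p2" "vanishes (Suc m) alpha"
    and sharp: "\<not> (vanishes (Suc m) p2 \<and> vanishes (Suc (Suc m)) alpha)"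
    and GE: "\<And>k l. vanishes k (coeff (coeff (G * E) l) k)"
  shows "vanishes (k - m) (coeff (coeff E l) k)"
proof (cases "vanishes (Suc m) p2")
  case False
  show ?thesis
  proof (induction k arbitrary: l)
    case 0
    then show ?case by (simp add: vanishes_0)
  next
    case (Suc k)
    show ?case
    proof (cases "m \<le> Suc k")
      case True
      have "vanishes (k - m + Suc m) (coeff (coeff E (Suc l)) k * alpha)"
        by (rule vanishes_mult[OF Suc.IH assms(2)])
      then have 1: "vanishes (Suc k) (coeff (coeff E (Suc l)) k * alpha)"
        by (rule vanishes_le) simp
      have "coeff (coeff E l) (Suc k) * p2 =
          coeff (coeff (G * E) (Suc l)) (Suc k) - coeff (coeff E (Suc l)) k * alpha"
        unfolding coeff_G_mult by (simp add: mult.commute)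
      then have "vanishes (Suc k) (coeff (coeff E l) (Suc k) * p2)"
        using vanishes_diff[OF GE 1] by simp
      then have "vanishes (Suc k - m + m) (coeff (coeff E l) (Suc k) * p2)"
        using True by simp
      then show ?thesis
        using False by (rule vanishes_cancel)
    qed (simp add: vanishes_0)
  qed
next
  case True
  with sharp have alpha: "\<not> vanishes (Suc (Suc m)) alpha"
    by simp
  show ?thesis
  proof (induction l arbitrary: k)
    case 0
    show ?case
    proof (cases "m \<le> k")
      case True
      have "coeff (coeff E 0) k * alpha = coeff (coeff (G * E) 0) (Suc k)"
        unfolding coeff_G_mult by (simp add: mult.commute)
      then have "vanishes (k - m + Suc m) (coeff (coeff E 0) k * alpha)"
        using GE[of "Suc k" 0] True by simp
      then show ?thesis
        using alpha by (rule vanishes_cancel)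
    qed (simp add: vanishes_0)
  next
    case (Suc l)
    show ?case
    proof (cases "m \<le> k")
      case True
      have "vanishes (Suc k - m + m) (coeff (coeff E l) (Suc k) * p2)"
        by (rule vanishes_mult[OF Suc.IH assms(1)])
      then have 1: "vanishes (Suc k) (coeff (coeff E l) (Suc k) * p2)"
        by (rule vanishes_le) simp
      have "coeff (coeff E (Suc l)) k * alpha =
          coeff (coeff (G * E) (Suc l)) (Suc k) - coeff (coeff E l) (Suc k) * p2"
        unfolding coeff_G_mult by (simp add: mult.commute)
      then have "vanishes (k - m + Suc m) (coeff (coeff E (Suc l)) k * alpha)"
        using vanishes_diff[OF GE 1] True by simp
      then show ?thesis
        using alpha by (rule vanishes_cancel)
    qed (simp add: vanishes_0)
  qed
qed

end


section \<open>Sylvester forms\<close>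

lemma det_sylvester:
  "det (vector [vector [y0, - y1], vector [a, b]] :: 'k::field A^2^2) = y0 * b + y1 * a"
  by (simp add: det_2)

text \<open>
  The determinant in the algorithm is multiplication by \<open>w = y\<^sub>1 / x\<^sub>0 = y\<^sub>0 / x\<^sub>1\<close>.
\<close>

lemma param_sylvester_step:
  "param (y0 * b + y1 * a) = [:Polynomial.monom 1 1:] * param (a * x0 + b * x1)"
  by (simp add: param.add param.mult param_simps smult_monom algebra_simps)

text \<open>
  The algorithm allows cofactors \<open>a\<close> and \<open>b\<close> of any bidegrees. A nonzero cofactor of a wrong bidegree would
  have to cancel against the other one, so it cannot occur: the part of the equation in the
  bidegree of the form shows that the other cofactor alone produces the form.
\<close>

lemma sylvester_step_bihomogeneous:
  fixes a b :: "'k::field A"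
  assumes "bihomogeneous (i, j) (a * x0 + b * x1)" "a * x0 + b * x1 \<noteq> 0"
    and "bihomogeneous e a" "bihomogeneous e' b"
  shows "0 < i" "bihomogeneous (i - 1, Suc j) (y0 * b + y1 * a)"
proof -
  have "a * x0 + b * x1 = bigraded_part (i, j) (a * x0 + b * x1)"
    by (simp add: bigraded_part_bihomogeneous[OF assms(1)])
  also have "\<dots> = (if 0 < i then bigraded_part (i - 1, j) a * x0 + bigraded_part (i - 1, j) b * x1 else 0)"
    by (auto simp: bigraded_part_add bigraded_part_mult[OF bihomogeneous_Inl])
  finally have F: "a * x0 + b * x1 = \<dots>" .
  with assms(2) show "0 < i"
    by (auto split: if_splits)
  with F have F: "a * x0 + b * x1 = bigraded_part (i - 1, j) a * x0 + bigraded_part (i - 1, j) b * x1"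
    by simp
  have cancel: "c * Var v = 0 \<Longrightarrow> c = 0" for c :: "'k A" and v
    using Var_mult_eq_0[of v c] by (simp add: mult.commute)
  have "bihomogeneous (i - 1, j) a \<and> bihomogeneous (i - 1, j) b"
  proof (cases "e = (i - 1, j)"; cases "e' = (i - 1, j)")
    assume "e = (i - 1, j)" "e' = (i - 1, j)"
    with assms show ?thesis by simp
  next
    assume e: "e = (i - 1, j)" "e' \<noteq> (i - 1, j)"
    with F have "b * x1 = 0"
      using assms by (simp add: bigraded_part_bihomogeneous)
    then have "b = 0"
      by (rule cancel)
    with e assms show ?thesis by (simp add: bihomogeneous_0)
  next
    assume e: "e \<noteq> (i - 1, j)" "e' = (i - 1, j)"
    with F have "a * x0 = 0"
      using assms by (simp add: bigraded_part_bihomogeneous)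
    then have "a = 0"
      by (rule cancel)
    with e assms show ?thesis by (simp add: bihomogeneous_0)
  next
    assume e: "e \<noteq> (i - 1, j)" "e' \<noteq> (i - 1, j)"
    with F have "a * x0 + b * x1 = 0"
      using assms by (simp add: bigraded_part_bihomogeneous)
    with assms show ?thesis by simp
  qed
  then show "bihomogeneous (i - 1, Suc j) (y0 * b + y1 * a)"
    using bihomogeneous_mult[OF bihomogeneous_Inr, of "(i - 1, j)"]
    by (intro bihomogeneous_add) fastforce+
qed

lemma param_nonzero_sylvester_step:
  fixes a b :: "'k::field A"
  assumes "param (a * x0 + b * x1) \<noteq> 0"
  shows "param (y0 * b + y1 * a) \<noteq> 0"
  using assms unfolding param_sylvester_step by (simp add: monom_eq_0_iff)

text \<open>
  Each step lowers the \<open>x\<close>-degree by one and keeps the image in \<open>T\<close> nonzero, and a nonzero form of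
  \<open>x\<close>-degree \<open>0\<close> is not in \<open>(x\<^sub>0, x\<^sub>1)\<close>. The cofactors are made bihomogeneous by taking parts.
\<close>

lemma sylvester_run_exists:
  fixes g :: "'k::field A"
  assumes "bihomogeneous (n, j) g" "param g \<noteq> 0"
  shows "\<exists>F m. sylvester_run g F m"
  using assms
proof (induction n arbitrary: g j)
  case (0 g j)
  have "g \<notin> ideal_gen {x0, x1}"
  proof
    assume "g \<in> ideal_gen {x0, x1}"
    then obtain r s where g: "g = r * x0 + s * x1"
      by (auto simp: ideal_gen_eq_span ideal_span_pair)
    have "g = bigraded_part (0, j) (r * x0 + s * x1)"
      unfolding g[symmetric] using 0 by (simp add: bigraded_part_bihomogeneous)
    also have "\<dots> = 0"
      by (simp add: bigraded_part_add bigraded_part_mult[OF bihomogeneous_Inl])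
    finally show False
      using 0 by (simp add: param.zero)
  qed
  then have "sylvester_run g (\<lambda>_. g) 0"
    by (simp add: sylvester_run_def)
  then show ?case by blast
next
  case (Suc n g j)
  show ?case
  proof (cases "g \<in> ideal_gen {x0, x1}")
    case True
    then obtain r s where g: "g = r * x0 + s * x1"
      by (auto simp: ideal_gen_eq_span ideal_span_pair)
    define a where "a = bigraded_part (n, j) r"
    define b where "b = bigraded_part (n, j) s"
    have "g = bigraded_part (Suc n, j) (r * x0 + s * x1)"
      unfolding g[symmetric] using Suc by (simp add: bigraded_part_bihomogeneous)
    also have "\<dots> = a * x0 + b * x1"
      by (simp add: bigraded_part_add bigraded_part_mult[OF bihomogeneous_Inl] a_def b_def)
    finally have ab: "g = a * x0 + b * x1" .
    have hom: "bihomogeneous (n, j) a" "bihomogeneous (n, j) b"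
      by (simp_all add: a_def b_def bihomogeneous_bigraded_part)
    define g' where "g' = y0 * b + y1 * a"
    have "g \<noteq> 0"
      using Suc.prems param.zero by auto
    then have "bihomogeneous (n, Suc j) g'"
      using sylvester_step_bihomogeneous(2)[of "Suc n" j a b] Suc.prems hom by (simp add: ab g'_def)
    moreover have "param g' \<noteq> 0"
      using Suc.prems unfolding g'_def ab by (intro param_nonzero_sylvester_step)
    ultimately obtain F m where F: "sylvester_run g' F m"
      using Suc.IH by blast
    have "sylvester_run g (case_nat g F) (Suc m)"
      unfolding sylvester_run_def
    proof (intro conjI allI impI)
      fix i assume i: "i < Suc m"
      show "case_nat g F i \<in> ideal_gen {x0, x1}"
        using i F True by (cases i) (auto simp: sylvester_run_def)
      show "\<exists>a b. (\<exists>e. bihomogeneous e a) \<and> (\<exists>e. bihomogeneous e b) \<and>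
          case_nat g F i = a * x0 + b * x1 \<and>
          case_nat g F (Suc i) = det (vector [vector [y0, - y1], vector [a, b]] :: 'k A^2^2)"
      proof (cases i)
        case 0
        have "F 0 = det (vector [vector [y0, - y1], vector [a, b]] :: 'k A^2^2)"
          using F by (simp add: sylvester_run_def det_sylvester g'_def)
        then show ?thesis
          using hom ab 0 by (intro exI[of _ a] exI[of _ b]) auto
      next
        case (Suc k)
        with i F show ?thesis
          by (simp add: sylvester_run_def)
      qed
    qed (use F in \<open>auto simp: sylvester_run_def\<close>)
    then show ?thesis by blast
  next
    case False
    then have "sylvester_run g (\<lambda>_. g) 0"
      by (simp add: sylvester_run_def)
    then show ?thesis by blast
  qed
qed

lemma sylvester_run_param:
  assumes "sylvester_run g F m" "i \<le> m"
  shows "param (F i) = [:Polynomial.monom 1 i:] * param g"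
  using assms(2)
proof (induction i)
  case 0
  then show ?case using assms(1) by (simp add: sylvester_run_def monom_0 pCons_one)
next
  case (Suc i)
  from Suc.prems assms(1) obtain a b where "F i = a * x0 + b * x1" "F (Suc i) = y0 * b + y1 * a"
    unfolding sylvester_run_def det_sylvester by (metis Suc_le_lessD)
  then have "param (F (Suc i)) = [:Polynomial.monom 1 1:] * param (F i)"
    by (simp only: param_sylvester_step)
  also have "param (F i) = [:Polynomial.monom 1 i:] * param g"
    using Suc by simp
  finally show ?case
    by (simp add: mult.assoc[symmetric] mult_monom smult_monom del: mult_pCons_left)
qed

lemma sylvester_run_bihomogeneous:
  assumes "sylvester_run g F m" "bihomogeneous (n, j) g" "param g \<noteq> 0" "i \<le> m"
  shows "i \<le> n \<and> bihomogeneous (n - i, j + i) (F i)"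
  using assms(4)
proof (induction i)
  case 0
  then show ?case using assms by (simp add: sylvester_run_def)
next
  case (Suc i)
  have "param (F i) \<noteq> 0"
    using sylvester_run_param[OF assms(1), of i] assms(3) Suc.prems by (simp add: monom_eq_0_iff)
  then have nz: "F i \<noteq> 0"
    using param.zero by auto
  from Suc.prems assms(1) obtain a b e e' where ab: "F i = a * x0 + b * x1" "F (Suc i) = y0 * b + y1 * a"
    "bihomogeneous e a" "bihomogeneous e' b"
    unfolding sylvester_run_def det_sylvester by (metis Suc_le_lessD)
  from Suc have "bihomogeneous (n - i, j + i) (a * x0 + b * x1)" "i \<le> n"
    by (simp_all add: ab)
  with sylvester_step_bihomogeneous[OF this(1) _ ab(3,4)] nz show ?case
    by (simp add: ab)
qed


section \<open>The defining ideal of the Rees algebra\<close>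

lemma ideal_span_sum_image:
  assumes "finite K" "\<And>k. k \<in> K \<Longrightarrow> t k \<in> param ` ideal_span S"
  shows "sum t K \<in> param ` ideal_span S"
  using assms
proof (induction K)
  case empty
  show ?case using ideal.span_zero param.zero by force
next
  case (insert k K)
  from insert.IH insert.prems obtain v where v: "v \<in> ideal_span S" "sum t K = param v"
    by blast
  from insert.prems[of k] obtain u where u: "u \<in> ideal_span S" "t k = param u"
    by blast
  have "sum t (insert k K) = param (u + v)"
    using insert.hyps by (simp add: u v param.add)
  then show ?case
    using ideal.span_add[OF u(1) v(1)] by blast
qed

context linear_syzygy_presentation
begin

definition g2 :: "'k A"
  where "g2 = R_to_A p0 * y0 + R_to_A p1 * y1 + R_to_A p2 * y2"

lemma param_g2: "param g2 = G"
  by (simp add: g2_def G_def alpha_def param.add param.mult param_R_to_A param_simps smult_monom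
      add_monom mult.commute monom_1_eq)

lemma coeff_monom_1_G:
  "coeff (coeff ([:Polynomial.monom 1 i:] * G) l) k =
    (if l = 0 \<and> k = Suc i then alpha else if l = 1 \<and> k = i then p2 else 0)"
  by (auto simp: G_def coeff_pCons mult_monom coeff_monom monom_0 split: nat.splits)

text \<open>
  The first two claims hold because \<open>w\<^sup>m G\<close>, the image of \<open>F\<^sub>m\<close>, has coefficients that vanish as
  required in the image of \<^const>\<open>param\<close>. If both orders were higher, then \<open>F\<^sub>m\<close> would be congruent to an
  element of \<open>(x\<^sub>0, x\<^sub>1)\<close> modulo the binomial, and the algorithm would not have stopped at \<open>m\<close>.
\<close>

lemma sylvester_run_vanishes:
  assumes "sylvester_run g2 F m"
  shows "vanishes m p2" "vanishes (Suc m) alpha"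
    "\<not> (vanishes (Suc m) p2 \<and> vanishes (Suc (Suc m)) alpha)"
proof -
  have F: "param (F m) = [:Polynomial.monom 1 m:] * G"
    using sylvester_run_param[OF assms, of m] by (simp add: param_g2)
  show "vanishes m p2"
    using vanishes_coeff_param[of m "F m" 1] unfolding F coeff_monom_1_G by simp
  show "vanishes (Suc m) alpha"
    using vanishes_coeff_param[of "Suc m" "F m" 0] unfolding F coeff_monom_1_G by simp
  show "\<not> (vanishes (Suc m) p2 \<and> vanishes (Suc (Suc m)) alpha)"
  proof
    assume v: "vanishes (Suc m) p2 \<and> vanishes (Suc (Suc m)) alpha"
    have "toric_section (param (F m)) \<in> ideal_span {x0, x1}"
      by (rule toric_section_in_x0_x1) (use v in \<open>auto simp: F coeff_monom_1_G vanishes_zero simp del: mult_pCons_left\<close>)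
    moreover have "toric_section (param (F m)) - F m \<in> ideal_span {x0, x1}"
    proof -
      obtain c where "toric_section (param (F m)) - F m = segre_form * c"
        using segre_form_dvd_toric_section_param[of "F m"] ..
      then have "toric_section (param (F m)) - F m = (c * y0) * x0 + (- c * y1) * x1"
        by (simp add: segre_form_def algebra_simps)
      then show ?thesis
        unfolding ideal_span_pair by blast
    qed
    ultimately have "F m \<in> ideal_span {x0, x1}"
      using ideal.span_diff by fastforce
    with assms show False
      by (simp add: sylvester_run_def ideal_gen_eq_span)
  qed
qed

text \<open>
  Of the factor \<open>w\<^sup>k\<close> the part \<open>w\<^sup>i\<close> with \<open>i = min k m\<close> turns \<open>G\<close> into the image of \<open>F\<^sub>i\<close>; the rest
  \<open>e w\<^sup>k\<^sup>-\<^sup>i y\<^sub>2\<^sup>l\<close> is itself in the image, since \<open>e\<close> vanishes to order \<open>k - m = k - i\<close>.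
\<close>

lemma monom_mult_G_in_image:
  assumes run: "sylvester_run g2 F m" and e: "vanishes (k - m) e"
  shows "Polynomial.monom (Polynomial.monom e k) l * G \<in> param ` ideal_span (insert segre_form (F ` {0..m}))"
proof -
  define i where "i = min k m"
  have e: "vanishes (k - i) e"
    using e by (rule vanishes_le) (simp add: i_def)
  define u where "u = toric_section (Polynomial.monom (Polynomial.monom e (k - i)) l)"
  have "param u = Polynomial.monom (Polynomial.monom e (k - i)) l"
    unfolding u_def by (rule param_toric_section) (use e in \<open>auto simp: coeff_monom vanishes_zero\<close>)
  moreover have "param (F i) = [:Polynomial.monom 1 i:] * G"
    using sylvester_run_param[OF run, of i] by (simp add: i_def param_g2)
  ultimately have "param (u * F i) =
      (Polynomial.monom (Polynomial.monom e (k - i)) l * [:Polynomial.monom 1 i:]) * G"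
    by (simp only: param.mult mult.assoc)
  also have "Polynomial.monom (Polynomial.monom e (k - i)) l * [:Polynomial.monom 1 i:] =
      Polynomial.monom (Polynomial.monom e k) l"
    by (simp add: mult_monom i_def flip: monom_0)
  finally have "Polynomial.monom (Polynomial.monom e k) l * G = param (u * F i)" ..
  moreover have "u * F i \<in> ideal_span (insert segre_form (F ` {0..m}))"
    by (intro ideal.span_scale ideal.span_base) (simp add: i_def)
  ultimately show ?thesis
    by blast
qed

text \<open>
  One inclusion holds because \<open>G\<close> divides the image of every generator. For the other, the image of an
  element \<open>q\<close> of the defining ideal is expanded into the terms of its cofactor; this gives an element
  \<open>u\<close> of the span with the same image, and \<open>q - u\<close> is a multiple of the binomial.
\<close>

theorem rees_ideal_generated:
  assumes run: "sylvester_run g2 F m"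
  shows "ideal_span (insert segre_form (F ` {0..m})) = rees_ideal (vector [rx1 * h, rx0 * h, f2]) I"
proof (intro equalityI subsetI)
  fix q assume "q \<in> ideal_span (insert segre_form (F ` {0..m}))"
  then have "G dvd param q"
  proof (induction q rule: ideal.span_induct_alt)
    case base
    show ?case by (simp add: param.zero)
  next
    case (step c x y)
    have "G dvd param x"
      using step(1) sylvester_run_param[OF run] unfolding param_g2
      by (auto simp: param_eq_0_iff[THEN iffD2] simp del: mult_pCons_left)
    with step show ?case
      by (simp add: param.add param.mult)
  qed
  then show "q \<in> rees_ideal (vector [rx1 * h, rx0 * h, f2]) I"
    by (simp add: rees_ideal_eq)
next
  let ?S = "ideal_span (insert segre_form (F ` {0..m}))"
  fix q assume "q \<in> rees_ideal (vector [rx1 * h, rx0 * h, f2]) I"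
  then obtain E where E: "param q = G * E"
    by (auto simp: rees_ideal_eq)
  have E': "vanishes (k - m) (coeff (coeff E l) k)" for k l
    by (rule vanishes_cofactor[OF sylvester_run_vanishes[OF run]])
      (simp add: E[symmetric] vanishes_coeff_param)
  have "param q = (\<Sum>l\<le>degree E. \<Sum>k\<le>degree (coeff E l).
      Polynomial.monom (Polynomial.monom (coeff (coeff E l) k) k) l * G)"
    unfolding sum_distrib_right[symmetric] monom_sum[symmetric] poly_as_sum_of_monoms
    using E by (simp add: mult.commute)
  also have "\<dots> \<in> param ` ?S"
    by (intro ideal_span_sum_image finite_atMost monom_mult_G_in_image[OF run] E')
  finally obtain u where u: "u \<in> ?S" "param q = param u"
    by blast
  then have "segre_form dvd q - u"
    by (simp add: param_eq_0_iff[symmetric] param.diff)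
  then have "q - u \<in> ?S"
    using ideal.span_mono[of "{segre_form}" "insert segre_form (F ` {0..m})"]
    by (auto simp: ideal_span_dvd[symmetric])
  then show "q \<in> ?S"
    using ideal.span_add[OF _ u(1)] by fastforce
qed

end


section \<open>Minimality\<close>

lemma segre_form_neq_0: "segre_form \<noteq> (0 :: 'k::field A)"
proof
  \<comment> \<open>The point with \<open>x\<^sub>1 = 0\<close> and all other coordinates \<open>1\<close> is not a zero of the binomial.\<close>
  define s where "s = (\<lambda>v :: 3 + 3. if v = Inl 2 then 0 else 1 :: 'k)"
  interpret e: ring_morphism "mpoly_eval (\<lambda>a. a) s"
    by (rule ring_morphism_mpoly_eval[OF ring_morphism_id])
  assume "segre_form = (0 :: 'k A)"
  then have "mpoly_eval (\<lambda>a. a) s segre_form = 0"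
    by (simp add: e.zero)
  then show False
    unfolding segre_form_def e.diff e.mult mpoly_eval_Var[OF ring_morphism_id] by (simp add: s_def)
qed

lemma bihomogeneous_segre_form: "bihomogeneous (1, 1) segre_form"
proof -
  have "bihomogeneous (1, 1) (Var (Inl i) * Var (Inr j) :: 'a A)" for i j
    using bihomogeneous_mult[OF bihomogeneous_Inl bihomogeneous_Inr, of i j] by simp
  then show ?thesis
    unfolding segre_form_def by (intro bihomogeneous_diff)
qed

lemma minimally_generatesI:
  assumes "ideal_span S = J" "\<And>x. x \<in> S \<Longrightarrow> x \<notin> ideal_span (S - {x})"
  shows "minimally_generates S J"
  unfolding minimally_generates_def ideal_gen_eq_span
proof (intro conjI allI impI notI)
  fix H assume H: "H \<subset> S" "ideal_span H = J"
  then obtain x where x: "x \<in> S" "x \<notin> H"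
    by blast
  then have "x \<in> ideal_span S"
    by (simp add: ideal.span_base)
  moreover have "ideal_span H \<subseteq> ideal_span (S - {x})"
    by (rule ideal.span_mono) (use H x in blast)
  ultimately show False
    using assms H x by blast
qed (rule assms(1))

text \<open>
  What minimality rests on: the bidegrees of the Sylvester forms, and that none of them is a multiple
  of the binomial.
\<close>

context
  fixes F :: "nat \<Rightarrow> 'k::field A" and n m :: nat
  assumes le: "\<And>i. i \<le> m \<Longrightarrow> i \<le> n"
    and hom: "\<And>i. i \<le> m \<Longrightarrow> bihomogeneous (n - i, Suc i) (F i)"
    and ndvd: "\<And>i. i \<le> m \<Longrightarrow> \<not> segre_form dvd F i"
begin

text \<open>
  In the bidegree of \<open>F\<^sub>i\<close> the other forms contribute nothing: \<open>F\<^sub>j\<close> has too large an \<open>x\<close>-degree for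
  \<open>j < i\<close> and too large a \<open>y\<close>-degree for \<open>j > i\<close>.
\<close>

lemma sylvester_form_not_in_span_others:
  assumes i: "i \<le> m"
  shows "F i \<notin> ideal_span (insert segre_form (F ` ({0..m} - {i})))"
proof
  have "segre_form dvd bigraded_part (n - i, Suc i) q"
    if "q \<in> ideal_span (insert segre_form (F ` ({0..m} - {i})))" for q
    using that
  proof (induction q rule: ideal.span_induct_alt)
    case base
    show ?case by (simp add: bigraded_part_bihomogeneous[OF bihomogeneous_0[of "(0, 0)"]])
  next
    case (step c x y)
    have "segre_form dvd bigraded_part (n - i, Suc i) (c * x)"
    proof (cases "x = segre_form")
      case True
      then show ?thesis
        by (simp add: bigraded_part_mult[OF bihomogeneous_segre_form])
    next
      case False
      with step(1) obtain j where "j \<in> {0..m} - {i}" and x: "x = F j"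
        by blast
      then have j: "j \<le> m" "j \<noteq> i"
        by simp_all
      then have "\<not> (n - j \<le> n - i \<and> Suc j \<le> Suc i)"
        using le[OF j(1)] le[OF i] by auto
      then show ?thesis
        unfolding x bigraded_part_mult[OF hom[OF j(1)]] by auto
    qed
    with step show ?case
      by (simp add: bigraded_part_add)
  qed
  moreover assume "F i \<in> ideal_span (insert segre_form (F ` ({0..m} - {i})))"
  ultimately have "segre_form dvd bigraded_part (n - i, Suc i) (F i)" .
  then show False
    using ndvd[OF i] by (simp add: bigraded_part_bihomogeneous[OF hom[OF i]])
qed

text \<open>
  In bidegree \<open>(1, 1)\<close> only \<open>F\<^sub>0\<close> contributes, and only if \<open>n = 1\<close>, with a cofactor \<open>c\<close> of bidegree
  \<open>(0, 0)\<close>. The binomial generates the prime ideal that is the kernel of \<^const>\<open>param\<close> and does not divide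
  \<open>F\<^sub>0\<close>, so it would divide \<open>c\<close>, which is impossible for degree reasons.
\<close>

lemma segre_form_not_in_span:
  assumes n: "n \<ge> 1"
  shows "segre_form \<notin> ideal_span (F ` {0..m})"
proof
  have "\<exists>c. bihomogeneous (0, 0) c \<and> bigraded_part (1, 1) q = c * F 0"
    if "q \<in> ideal_span (F ` {0..m})" for q
    using that
  proof (induction q rule: ideal.span_induct_alt)
    case base
    show ?case
      by (rule exI[of _ 0])
        (simp add: bihomogeneous_0 bigraded_part_bihomogeneous[OF bihomogeneous_0[of "(0, 0)"]])
  next
    case (step c x y)
    from step obtain c' where c': "bihomogeneous (0, 0) c'" "bigraded_part (1, 1) y = c' * F 0"
      by blast
    from step(1) obtain j where j: "j \<le> m" "x = F j"
      by auto
    have "\<exists>c''. bihomogeneous (0, 0) c'' \<and> bigraded_part (1, 1) (c * x) = c'' * F 0"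
    proof (cases "j = 0 \<and> n = 1")
      case True
      then show ?thesis
        using bigraded_part_mult[OF hom[OF j(1)], of 1 1 c] j(2)
        by (intro exI[of _ "bigraded_part (0, 0) c"]) (simp add: bihomogeneous_bigraded_part)
    next
      case False
      then have "bigraded_part (1, 1) (c * x) = 0"
        unfolding j(2) bigraded_part_mult[OF hom[OF j(1)]] using n by auto
      then show ?thesis
        by (intro exI[of _ 0]) (simp add: bihomogeneous_0)
    qed
    then obtain c'' where "bihomogeneous (0, 0) c''" "bigraded_part (1, 1) (c * x) = c'' * F 0"
      by blast
    with c' show ?case
      by (intro exI[of _ "c'' + c'"]) (simp add: bigraded_part_add bihomogeneous_add distrib_right)
  qed
  moreover assume "segre_form \<in> ideal_span (F ` {0..m})"
  ultimately have "\<exists>c. bihomogeneous (0, 0) c \<and> bigraded_part (1, 1) segre_form = c * F 0" .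
  then obtain c where c: "bihomogeneous (0, 0) c" "segre_form = c * F 0"
    by (auto simp: bigraded_part_bihomogeneous[OF bihomogeneous_segre_form])
  have "param c * param (F 0) = 0"
    unfolding param.mult[symmetric] c(2)[symmetric] by (rule param_segre_form)
  moreover have "param (F 0) \<noteq> 0"
    using ndvd[of 0] by (simp add: param_eq_0_iff)
  ultimately have "segre_form dvd c"
    by (simp add: param_eq_0_iff)
  then obtain r where r: "c = r * segre_form"
    by (metis dvdE mult.commute)
  have "c = bigraded_part (0, 0) (r * segre_form)"
    unfolding r[symmetric] by (simp add: bigraded_part_bihomogeneous[OF c(1)])
  also have "\<dots> = 0"
    by (simp add: bigraded_part_mult[OF bihomogeneous_segre_form])
  finally show False
    using c by (simp add: segre_form_neq_0)
qed

lemma minimally_generated_by_sylvester_forms: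
  assumes n: "n \<ge> 1" and J: "ideal_span (insert segre_form (F ` {0..m})) = J"
  shows "minimally_generates (insert segre_form (F ` {0..m})) J"
    "minimally_generated_in_bidegrees J ((1, 1) # map (\<lambda>i. (n - i, i + 1)) [0..<m + 1])"
proof -
  have ne: "F i \<noteq> segre_form" if "i \<le> m" for i
    using ndvd[OF that] by auto
  show min: "minimally_generates (insert segre_form (F ` {0..m})) J"
  proof (rule minimally_generatesI[OF J])
    fix x assume "x \<in> insert segre_form (F ` {0..m})"
    then consider "x = segre_form" | i where "i \<le> m" "x = F i"
      by auto
    then show "x \<notin> ideal_span (insert segre_form (F ` {0..m}) - {x})"
    proof cases
      case 1
      have "ideal_span (insert segre_form (F ` {0..m}) - {x}) \<subseteq> ideal_span (F ` {0..m})"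
        by (rule ideal.span_mono) (use 1 in blast)
      then show ?thesis
        using segre_form_not_in_span[OF n] 1 by blast
    next
      case 2
      have "ideal_span (insert segre_form (F ` {0..m}) - {x}) \<subseteq>
          ideal_span (insert segre_form (F ` ({0..m} - {i})))"
        by (rule ideal.span_mono) (use 2 in blast)
      then show ?thesis
        using sylvester_form_not_in_span_others[OF 2(1)] 2(2) by blast
    qed
  qed
  have "inj_on F {0..m}"
  proof (rule inj_onI, rule ccontr)
    fix i j assume ij: "i \<in> {0..m}" "j \<in> {0..m}" "F i = F j" "i \<noteq> j"
    then have "F i \<in> ideal_span (insert segre_form (F ` ({0..m} - {i})))"
      by (intro ideal.span_base) auto
    then show False
      using sylvester_form_not_in_span_others[of i] ij by simp
  qed
  moreover have "{0..<m + 1} = {0..m}"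
    by auto
  ultimately have dist: "distinct (segre_form # map F [0..<m + 1])"
    and set: "set (segre_form # map F [0..<m + 1]) = insert segre_form (F ` {0..m})"
    using ne ne[symmetric] by (auto simp: distinct_map simp del: upt_Suc)
  have "list_all2 (\<lambda>g e. g \<noteq> 0 \<and> bihomogeneous e g) (segre_form # map F [0..<m + 1])
      ((1, 1) # map (\<lambda>i. (n - i, i + 1)) [0..<m + 1])"
  proof -
    have "F i \<noteq> 0 \<and> bihomogeneous (n - i, i + 1) (F i)" if "i \<le> m" for i
      using hom[OF that] ndvd[OF that] by auto
    then have "list_all2 (\<lambda>g e. g \<noteq> 0 \<and> bihomogeneous e g) (map F [0..<m + 1])
        (map (\<lambda>i. (n - i, i + 1)) [0..<m + 1])"
      by (auto simp: list_all2_conv_all_nth simp del: upt_Suc)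
    then show ?thesis
      using bihomogeneous_segre_form by (simp add: segre_form_neq_0 del: upt_Suc)
  qed
  then show "minimally_generated_in_bidegrees J ((1, 1) # map (\<lambda>i. (n - i, i + 1)) [0..<m + 1])"
    unfolding minimally_generated_in_bidegrees_def
    by (intro exI[of _ "segre_form # map F [0..<m + 1]"] conjI dist) (simp_all only: set min)
qed

end


section \<open>The theorem\<close>

context linear_syzygy_presentation
begin

theorem sylvester_forms_minimally_generate:
  assumes n: "n \<ge> 1" and p: "homogeneous n p0" "homogeneous n p1" "homogeneous n p2"
  shows "\<exists>F m. sylvester_run g2 F m"
    and "sylvester_run g2 F m \<Longrightarrow>
      minimally_generates ({segre_form, g2} \<union> F ` {1..m}) (rees_ideal (vector [rx1 * h, rx0 * h, f2]) I) \<and>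
      m \<le> n \<and>
      minimally_generated_in_bidegrees (rees_ideal (vector [rx1 * h, rx0 * h, f2]) I)
        ((1, 1) # map (\<lambda>i. (n - i, i + 1)) [0..<m + 1])"
proof -
  have "bihomogeneous (n, 1) (R_to_A q * Var (Inr j))" if "homogeneous n q" for q :: "'k R" and j
    using bihomogeneous_mult[OF bihomogeneous_R_to_A[OF that] bihomogeneous_Inr] by simp
  then have g2: "bihomogeneous (n, 1) g2"
    unfolding g2_def using p by (intro bihomogeneous_add)
  have nz: "param g2 \<noteq> 0"
    by (simp add: param_g2 G_nonzero)
  show "\<exists>F m. sylvester_run g2 F m"
    by (rule sylvester_run_exists[OF g2 nz])
  assume run: "sylvester_run g2 F m"
  have hom: "i \<le> n \<and> bihomogeneous (n - i, Suc i) (F i)" if "i \<le> m" for i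
    using sylvester_run_bihomogeneous[OF run g2 nz that] by simp
  have ndvd: "\<not> segre_form dvd F i" if "i \<le> m" for i
    using sylvester_run_param[OF run that] nz by (simp add: param_eq_0_iff[symmetric] monom_eq_0_iff)
  have "{0..m} = insert 0 {1..m}"
    by auto
  then have "{segre_form, g2} \<union> F ` {1..m} = insert segre_form (F ` {0..m})"
    using run by (auto simp: sylvester_run_def)
  moreover note minimally_generated_by_sylvester_forms[of m n F, OF _ _ ndvd n rees_ideal_generated[OF run]]
  ultimately show "minimally_generates ({segre_form, g2} \<union> F ` {1..m}) (rees_ideal (vector [rx1 * h, rx0 * h, f2]) I) \<and>
      m \<le> n \<and>
      minimally_generated_in_bidegrees (rees_ideal (vector [rx1 * h, rx0 * h, f2]) I)
        ((1, 1) # map (\<lambda>i. (n - i, i + 1)) [0..<m + 1])"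
    using hom by (simp del: upt_Suc)
qed

end

text \<open>
  The first column says \<open>f\<^sub>0 x\<^sub>0 = f\<^sub>1 x\<^sub>1\<close>, whence \<open>x\<^sub>0\<close> divides \<open>f\<^sub>1\<close>; the quotient is \<open>h\<close>.
\<close>

lemma hilbert_burch_linear_syzygy:
  fixes f0 f1 f2 p0 p1 p2 :: "'k::field R"
  assumes pres: "hilbert_burch_presentation d 1 n
      (vector [vector [rx0, p0], vector [- rx1, p1], vector [0, p2]]) (vector [f0, f1, f2]) I"
    and n: "n \<ge> 1"
  shows "homogeneous n p0" "homogeneous n p1" "homogeneous n p2"
    "\<exists>h. f0 = rx1 * h \<and> f1 = rx0 * h \<and> linear_syzygy_presentation h f2 p0 p1 p2"
proof -
  define M :: "'k R^2^3" where "M = vector [vector [rx0, p0], vector [- rx1, p1], vector [0, p2]]"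
  define f :: "'k R^3" where "f = vector [f0, f1, f2]"
  have M_mult: "M *v u = vector [rx0 * u $ 1 + p0 * u $ 2, - rx1 * u $ 1 + p1 * u $ 2, p2 * u $ 2]" for u
    by (simp add: vec_eq_iff forall_3 matrix_vector_mult_def sum_2 M_def)
  have pres: "hilbert_burch_presentation d 1 n M f I"
    using pres by (simp add: M_def f_def)
  then have "homogeneous n (M $ i $ 2)" for i
    by (simp add: hilbert_burch_presentation_def)
  from this[of 1] this[of 2] this[of 3]
  show hom: "homogeneous n p0" "homogeneous n p1" "homogeneous n p2"
    by (simp_all add: M_def)
  have inj: "inj ((*v) M)"
    and range: "range ((*v) M) = {u. (\<Sum>i\<in>UNIV. f $ i * u $ i) = 0}"
    using pres by (simp_all add: hilbert_burch_presentation_def)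
  have complex: "f0 * (rx0 * a + p0 * b) + f1 * (- rx1 * a + p1 * b) + f2 * (p2 * b) = 0" for a b
  proof -
    have "M *v vector [a, b] \<in> {u. (\<Sum>i\<in>UNIV. f $ i * u $ i) = 0}"
      unfolding range[symmetric] by (rule rangeI)
    then show ?thesis
      by (simp add: M_mult f_def sum_3)
  qed
  have exact: "\<exists>a b. u0 = a * rx0 + b * p0 \<and> u1 = b * p1 - a * rx1 \<and> u2 = b * p2"
    if "f0 * u0 + f1 * u1 + f2 * u2 = 0" for u0 u1 u2
  proof -
    have "vector [u0, u1, u2] \<in> range ((*v) M)"
      unfolding range using that by (simp add: f_def sum_3)
    then obtain v where "(vector [u0, u1, u2] :: 'k R^3) = M *v v"
      by blast
    then have "u0 = rx0 * v $ 1 + p0 * v $ 2" "u1 = - rx1 * v $ 1 + p1 * v $ 2" "u2 = p2 * v $ 2"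
      by (simp_all add: M_mult vec_eq_iff forall_3)
    then show ?thesis
      by (intro exI[of _ "v $ 1"] exI[of _ "v $ 2"]) (simp add: mult.commute)
  qed
  have "f0 * rx0 = f1 * rx1"
    using complex[of 1 0] by simp
  then have "rx1 * f1 = rx0 * f0"
    by (simp add: mult.commute)
  then have "rx0 dvd rx1 * f1" ..
  then have "rx0 dvd f1"
    by (rule rx0_dvd_rx1_mult_imp_dvd)
  then obtain h where f1: "f1 = rx0 * h" ..
  have "rx0 * (f0 - rx1 * h) = rx0 * f0 - rx1 * f1"
    unfolding f1 by (simp add: algebra_simps)
  then have "rx0 * (f0 - rx1 * h) = 0"
    using \<open>rx1 * f1 = rx0 * f0\<close> by simp
  then have "f0 - rx1 * h = 0"
    by (rule Var_mult_eq_0)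
  then have f0: "f0 = rx1 * h"
    by simp
  have "linear_syzygy_presentation h f2 p0 p1 p2"
  proof
    show "h * (rx1 * p0 + rx0 * p1) + f2 * p2 = 0"
      using complex[of 0 1] by (simp add: f0 f1 algebra_simps)
    show "\<exists>a b. u0 = a * rx0 + b * p0 \<and> u1 = b * p1 - a * rx1 \<and> u2 = b * p2"
      if "rx1 * h * u0 + rx0 * h * u1 + f2 * u2 = 0" for u0 u1 u2
      by (rule exact) (use that in \<open>simp add: f0 f1\<close>)
    show "a = 0 \<and> b = 0"
      if "a * rx0 + b * p0 = 0" "b * p1 - a * rx1 = 0" "b * p2 = 0" for a b
    proof -
      have "M *v vector [a, b] = M *v 0"
        using that by (simp add: M_mult vec_eq_iff forall_3 mult.commute)
      then have "vector [a, b] = (0 :: 'k R^2)"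
        by (rule injD[OF inj])
      then show ?thesis
        by (simp add: vec_eq_iff forall_2)
    qed
    show "mpoly_eval (\<lambda>a. a) (\<lambda>_. 0) p0 = 0"
      using homogeneous_eval_0[OF hom(1)] n by simp
  qed
  with f0 f1 show "\<exists>h. f0 = rx1 * h \<and> f1 = rx0 * h \<and> linear_syzygy_presentation h f2 p0 p1 p2"
    by blast
qed

theorem theorem5p12:
  fixes f0 f1 f2 p0 p1 p2 :: "'k::field R"
    and d :: nat
    and I :: "'k R set"
    and \<phi> :: "'k R^2^3"
    and g1 g2 :: "'k A"
  assumes homogeneous: "homogeneous d f0" "homogeneous d f1" "homogeneous d f2"
    and dominant: "dominant (vector [f0, f1, f2])"
    and I: "I = ideal_gen {f0, f1, f2}"
    and saturated: "saturated I"
    and dim: "krull_dim (cring_class_ops Quot I) = 1"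
    and \<phi>: "\<phi> = vector [vector [rx0, p0], vector [- rx1, p1], vector [0, p2]]"
    and d: "d - 1 \<ge> 1"
    and presentation: "hilbert_burch_presentation d 1 (d - 1) \<phi> (vector [f0, f1, f2]) I"
    and minors: "I = ideal_gen (maximal_minors \<phi>)"
    and g1: "g1 = x0 * y0 - x1 * y1"
    and g2: "g2 = R_to_A p0 * y0 + R_to_A p1 * y1 + R_to_A p2 * y2"
  shows "(\<exists>F m. sylvester_run g2 F m) \<and>
    (\<forall>F m. sylvester_run g2 F m \<longrightarrow>
      minimally_generates ({g1, g2} \<union> F ` {1..m}) (rees_ideal (vector [f0, f1, f2]) I) \<and>
      m \<le> d - 1 \<and>
      minimally_generated_in_bidegrees (rees_ideal (vector [f0, f1, f2]) I)
        ((1, 1) # map (\<lambda>i. (d - 1 - i, i + 1)) [0..<m + 1]))"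
proof -
  note hb = hilbert_burch_linear_syzygy[OF presentation[unfolded \<phi>] d]
  obtain h where f: "f0 = rx1 * h" "f1 = rx0 * h" and "linear_syzygy_presentation h f2 p0 p1 p2"
    using hb(4) by blast
  interpret linear_syzygy_presentation h f2 p0 p1 p2
    by fact
  have "g1 = segre_form" "g2 = linear_syzygy_presentation.g2 p0 p1 p2"
    by (simp_all add: g1 g2 segre_form_def g2_def)
  then show ?thesis
    unfolding f using sylvester_forms_minimally_generate[OF d hb(1-3)] by blast
qed

end
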